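(* Fix $C_\star>(3+\sqrt5)^2$ and $\kappa\ge 2C_\star$. Let $h,\gamma>0$ satisfy $h<2/\sqrt\kappa$, and set $\beta=e^{-\gamma h}$, $s=\frac{h^2}{2}(1+\beta)$, $q_\kappa=\frac{1-C_\star/\kappa}{1+C_\star/\kappa}$. (i) Suppose $\lambda\in[1,\kappa]$ is such that, for $U_\lambda(x)=\lambda|x|^2/2$ on $\mathbb R^2$, there are two initial states $y,\widetilde y\in\mathbb R^4$ with $$\lim_{n\to\infty}\bigl\|\delta_y(Q_{h,\gamma}^{U_\lambda})^n-\delta_{\widetilde y}(Q_{h,\gamma}^{U_\lambda})^n\bigr\|_{\mathrm{TV}}^{1/n}=\rho_{\mathrm q}(s,\beta;\kappa)\ge q_\kappa .$$ Let $\pi_\lambda$ be the unique invariant law of $Q_{h,\gamma}^{U_\lambda}$. Then there are initial states $z,\widetilde z\in\mathbb R^4$ and a constant $c>0$ such that, for every $\varepsilon\in(0,c/4]$, there exists $z_\varepsilon\in\{z,\widetilde z\}$ satisfying $$t_{\mathrm{mix}}(z_\varepsilon,\varepsilon;Q_{h,\gamma}^{U_\lambda},\pi_\lambda)\ \ge\ \frac{\kappa}{3C_\star}\log\frac{c}{4\varepsilon}-1 .$$ (ii) Suppose $U\in\mathcal U_\kappa^2$ and $c_0,C_0>0$ are such that, for every $R\ge1$, the potential $U_R(x)=R^2U(x/R)$ belongs to $\mathcal U_\kappa^2$, the kernel $Q_{h,\gamma}^{U_R}$ has a unique invariant law $\pi_R$, and there is $z_R\in\mathbb R^4$ with $W_2(\delta_{z_R},\pi_R)\le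 C_0(1+R)$ and $\|\delta_{z_R}(Q_{h,\gamma}^{U_R})^n-\pi_R\|_{\mathrm{TV}}\ge\frac38$ for all integers $0\le n\le\lfloor\frac1{16}e^{c_0R^2}\rfloor$. Then, for every $R\ge1$ and every $\varepsilon\in(0,3/8)$, $$t_{\mathrm{mix}}\bigl(z_R,\varepsilon;Q_{h,\gamma}^{U_R},\pi_R\bigr)>\Bigl\lfloor\tfrac1{16}e^{c_0R^2}\Bigr\rfloor,\qquad W_2(\delta_{z_R},\pi_R)\le C_0(1+R).$$
   Context: OBABO chain. For a differentiable $U:\mathbb R^d\to\mathbb R$ and $h,\gamma>0$, put $r=e^{-\gamma h/2}$, $\beta=r^2=e^{-\gamma h}$, $\sigma=(1-\beta)^{1/2}$. One OBABO step maps $(x,v)\in\mathbb R^d\times\mathbb R^d$ to $(x^+,v^+)$ by $v^{(a)}=rv+\sigma\xi^{(1)}$, $v^{(b)}=v^{(a)}-\frac h2\nabla U(x)$, $x^+=x+hv^{(b)}$, $v^{(c)}=v^{(b)}-\frac h2\nabla U(x^+)$, $v^+=rv^{(c)}+\sigma\xi^{(2)}$, where $\xi^{(1)},\xi^{(2)}$ are independent $\mathcal N(0,\mathrm{Id}_d)$. Iterating with i.i.d. copies of $(\xi^{(1)},\xi^{(2)})$ defines a Markov chain with transition kernel $Q_{h,\gamma}^U$. $\mathcal U_\kappa^d=\{U\in C^\infty(\mathbb R^d): \mathrm{Id}_d\preceq\nabla^2U(x)\preceq\kappa\,\mathrm{Id}_d\text{ for every }x\}$. $\|\nu-\widetilde\nu\|_{\mathrm{TV}}=\sup_A|\nu(A)-\widetilde\nu(A)|$;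 $W_2$ is the Euclidean $2$-Wasserstein distance; $\delta_z$ is the Dirac mass at $z$. For a Markov kernel $Q$ with invariant law $\pi$, $t_{\mathrm{mix}}(z,\varepsilon;Q,\pi)=\inf\{n\ge0:\|\delta_zQ^n-\pi\|_{\mathrm{TV}}\le\varepsilon\}$, with $\inf\varnothing=\infty$. $A_\lambda(s,\beta)=\begin{pmatrix}1+\beta-s\lambda&-\beta\\1&0\end{pmatrix}$ and $\rho_{\mathrm q}(s,\beta;\kappa)=\max_{\lambda\in[1,\kappa]}\rho(A_\lambda(s,\beta))$, with $\rho(\cdot)$ the spectral radius. *)

theory Defs
  imports
    "HOL-Probability.Probability"
    "Jordan_Normal_Form.Spectral_Radius"
begin

no_notation Matrix.vec_index (infixl "$" 100)
no_notation Matrix.scalar_prod (infix "\<bullet>" 70)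

text \<open>Euclidean space \<open>\<real>\<^sup>d\<close> is a type \<open>'a::euclidean_space\<close>, and phase space is \<open>'a \<times> 'a\<close>, whose
  library metric is the Euclidean one, so \<open>(real^2) \<times> (real^2)\<close> plays the role of \<open>\<real>\<^sup>4\<close>.\<close>

section \<open>Potentials\<close>

definition gradient :: "('a::real_inner \<Rightarrow> real) \<Rightarrow> 'a \<Rightarrow> 'a" where
  "gradient U x = (THE D. GDERIV U x :> D)"

definition hessian :: "('a::real_inner \<Rightarrow> real) \<Rightarrow> 'a \<Rightarrow> 'a \<Rightarrow> 'a" where
  "hessian U x = frechet_derivative (gradient U) (at x)"

primrec cont_diff :: "nat \<Rightarrow> ('a::real_normed_vector \<Rightarrow> real) \<Rightarrow> bool" where
  "cont_diff 0 f \<longleftrightarrow> continuous_on UNIV f"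
| "cont_diff (Suc k) f \<longleftrightarrow>
     (\<forall>x. f differentiable (at x)) \<and> (\<forall>v. cont_diff k (\<lambda>x. frechet_derivative f (at x) v))"

definition smooth :: "('a::real_normed_vector \<Rightarrow> real) \<Rightarrow> bool" where
  "smooth f \<longleftrightarrow> (\<forall>k. cont_diff k f)"

definition pos_semidef :: "('a::real_inner \<Rightarrow> 'a) \<Rightarrow> bool" where
  "pos_semidef T \<longleftrightarrow> linear T \<and> (\<forall>x y. T x \<bullet> y = x \<bullet> T y) \<and> (\<forall>x. 0 \<le> x \<bullet> T x)"

definition loewner_le :: "('a::real_inner \<Rightarrow> 'a) \<Rightarrow> ('a \<Rightarrow> 'a) \<Rightarrow> bool" where
  "loewner_le S T \<longleftrightarrow> pos_semidef (\<lambda>x. T x - S x)"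

definition potentials :: "real \<Rightarrow> ('a::euclidean_space \<Rightarrow> real) set" where
  "potentials \<kappa> = {U. smooth U \<and>
     (\<forall>x. loewner_le (\<lambda>w. w) (hessian U x) \<and> loewner_le (hessian U x) (\<lambda>w. \<kappa> *\<^sub>R w))}"

definition quadratic_potential :: "real \<Rightarrow> 'a::euclidean_space \<Rightarrow> real" where
  "quadratic_potential l x = l * (norm x)\<^sup>2 / 2"

definition rescaled_potential :: "real \<Rightarrow> ('a::euclidean_space \<Rightarrow> real) \<Rightarrow> 'a \<Rightarrow> real" where
  "rescaled_potential R U x = R\<^sup>2 * U (x /\<^sub>R R)"

section \<open>Markov kernels, distances and mixing times\<close>

definition invariant_law :: "('s::topological_space \<Rightarrow> 's measure) \<Rightarrow> 's measure \<Rightarrow> bool" where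
  "invariant_law Q \<pi> \<longleftrightarrow> prob_space \<pi> \<and> sets \<pi> = sets borel \<and> \<pi> \<bind> Q = \<pi>"

definition unique_invariant_law :: "('s::topological_space \<Rightarrow> 's measure) \<Rightarrow> 's measure \<Rightarrow> bool" where
  "unique_invariant_law Q \<pi> \<longleftrightarrow> invariant_law Q \<pi> \<and> (\<forall>\<pi>'. invariant_law Q \<pi>' \<longrightarrow> \<pi>' = \<pi>)"

definition dirac :: "'s::topological_space \<Rightarrow> 's measure" where
  "dirac z = return borel z"

text \<open>The law \<open>\<delta>\<^sub>z Q\<^sup>n\<close>.\<close>

primrec law_after :: "('s::topological_space \<Rightarrow> 's measure) \<Rightarrow> 's \<Rightarrow> nat \<Rightarrow> 's measure" where
  "law_after Q z 0 = dirac z"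
| "law_after Q z (Suc n) = law_after Q z n \<bind> Q"

definition tv_dist :: "'s measure \<Rightarrow> 's measure \<Rightarrow> real" where
  "tv_dist \<mu> \<nu> = (SUP A\<in>sets \<mu>. \<bar>measure \<mu> A - measure \<nu> A\<bar>)"

definition couplings :: "'s measure \<Rightarrow> 's measure \<Rightarrow> ('s \<times> 's) measure set" where
  "couplings \<mu> \<nu> = {\<Gamma>. prob_space \<Gamma> \<and> sets \<Gamma> = sets (\<mu> \<Otimes>\<^sub>M \<nu>) \<and>
     distr \<Gamma> \<mu> fst = \<mu> \<and> distr \<Gamma> \<nu> snd = \<nu>}"

definition ennreal_sqrt :: "ennreal \<Rightarrow> ennreal" where
  "ennreal_sqrt x = (if x = \<infinity> then \<infinity> else ennreal (sqrt (enn2real x)))"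

definition wasserstein2 :: "'s::metric_space measure \<Rightarrow> 's measure \<Rightarrow> ennreal" where
  "wasserstein2 \<mu> \<nu> =
     ennreal_sqrt (INF \<Gamma>\<in>couplings \<mu> \<nu>. \<integral>\<^sup>+p. ennreal ((dist (fst p) (snd p))\<^sup>2) \<partial>\<Gamma>)"

text \<open>In \<open>enat\<close> the infimum of the empty set is \<open>\<infinity>\<close>.\<close>

definition mixing_time ::
    "'s::topological_space \<Rightarrow> real \<Rightarrow> ('s \<Rightarrow> 's measure) \<Rightarrow> 's measure \<Rightarrow> enat" where
  "mixing_time z \<epsilon> Q \<pi> = Inf (enat ` {n. tv_dist (law_after Q z n) \<pi> \<le> \<epsilon>})"

section \<open>The OBABO chain\<close>

definition std_gaussian :: "'a::euclidean_space measure" where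
  "std_gaussian = density lborel (\<lambda>x. ennreal (\<Prod>b\<in>Basis. std_normal_density (x \<bullet> b)))"

definition obabo_step ::
    "('a::euclidean_space \<Rightarrow> real) \<Rightarrow> real \<Rightarrow> real \<Rightarrow> 'a \<times> 'a \<Rightarrow> 'a \<times> 'a \<Rightarrow> 'a \<times> 'a" where
  "obabo_step U h \<gamma> = (\<lambda>(x, v) (\<xi>\<^sub>1, \<xi>\<^sub>2).
     let r = exp (- \<gamma> * h / 2);
         \<sigma> = sqrt (1 - r\<^sup>2);
         va = r *\<^sub>R v + \<sigma> *\<^sub>R \<xi>\<^sub>1;
         vb = va - (h / 2) *\<^sub>R gradient U x;
         x' = x + h *\<^sub>R vb;
         vc = vb - (h / 2) *\<^sub>R gradient U x';
         v' = r *\<^sub>R vc + \<sigma> *\<^sub>R \<xi>\<^sub>2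
     in (x', v'))"

definition obabo_kernel ::
    "('a::euclidean_space \<Rightarrow> real) \<Rightarrow> real \<Rightarrow> real \<Rightarrow> 'a \<times> 'a \<Rightarrow> ('a \<times> 'a) measure" where
  "obabo_kernel U h \<gamma> z = distr (std_gaussian \<Otimes>\<^sub>M std_gaussian) borel (obabo_step U h \<gamma> z)"

section \<open>The quadratic rate\<close>

definition companion_mat :: "real \<Rightarrow> real \<Rightarrow> real \<Rightarrow> complex mat" where
  "companion_mat l s \<beta> =
     map_mat complex_of_real (mat_of_rows_list 2 [[1 + \<beta> - s * l, - \<beta>], [1, 0]])"

text \<open>The supremum is a maximum: the spectral radius is continuous in \<open>l\<close> and the interval is
  compact.\<close>

definition quadratic_rate :: "real \<Rightarrow> real \<Rightarrow> real \<Rightarrow> real" where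
  "quadratic_rate s \<beta> \<kappa> = (SUP l\<in>{1..\<kappa>}. spectral_radius (companion_mat l s \<beta>))"

end

theory Submission
  imports Defs
begin

text \<open>
  Part (ii) is a reading of the definition of the mixing time: a total variation distance of at
  least 3/8 at all times up to \<open>\<lfloor>exp (c\<^sub>0 R\<^sup>2) / 16\<rfloor>\<close> excludes those times from the set whose infimum
  is the mixing time, and in \<open>enat\<close> a finite infimum is attained
  (\<open>mixing_time_greater\<close>). The transport bound is one of the hypotheses.

  Part (i) has two ingredients. The first is a general principle for Markov chains,
  \<open>mixing_time_of_tv_rate\<close>. Let \<open>T n\<close> be the total variation distance between the laws at time \<open>n\<close>
  of two copies of the chain. If the \<open>n\<close>-th root of \<open>T n\<close> has a limit larger than \<open>e\<^sup>-\<^sup>a\<close>, then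
  \<open>T n \<ge> c e\<^sup>-\<^sup>a\<^sup>n\<close> for all \<open>n\<close>. Once both copies are \<open>\<epsilon>\<close>-close to equilibrium they are
  \<open>2\<epsilon>\<close>-close to each other, so the slower one needs at least \<open>ln (c / (2\<epsilon>)) / a\<close> steps,
  a little more than is claimed. This rests on the fact that total variation does not increase
  along a Markov chain (\<open>tv_dist_bind_le\<close>). Here \<open>a = 3 C / \<kappa>\<close> is admissible, because \<open>e\<^sup>-\<^sup>3\<^sup>x < (1 - x) / (1 + x)\<close>
  for \<open>x = C / \<kappa> \<le> 1/2\<close>.

  The second ingredient is that the OBABO chain of a quadratic potential has exactly one invariant
  law. Its leapfrog part is, after rescaling the position by a frequency \<open>\<omega>\<close>, a rotation of phase
  space, and its thermostat part is a rotation of the pair of velocity and noise. A pair of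
  independent standard Gaussian vectors is invariant under rotations
  (\<open>nn_integral_std_gaussian_rotation\<close>), which gives an explicit Gaussian invariant law.
  For uniqueness, two copies driven by the same noise contract geometrically in the modified energy
  (\<open>energy_dist_contraction\<close>), and a chain of contracting random maps has at most one invariant
  law (\<open>invariant_law_unique_of_contraction\<close>).
\<close>

section \<open>Total variation under a Markov kernel\<close>

lemma bind_kernel_in_prob_algebra:
  assumes "\<mu> \<in> space (prob_algebra M)" "Q \<in> M \<rightarrow>\<^sub>M prob_algebra N"
  shows "\<mu> \<bind> Q \<in> space (prob_algebra N)"
  using prob_space_bind'[OF assms] sets_bind'[OF assms] by (simp add: space_prob_algebra)

lemma law_after_in_prob_algebra:
  assumes Q: "Q \<in> borel \<rightarrow>\<^sub>M prob_algebra borel"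
  shows "law_after Q z n \<in> space (prob_algebra borel)"
proof (induction n)
  case 0
  show ?case by (simp add: dirac_def space_prob_algebra prob_space_return)
next
  case (Suc n)
  then show ?case by (simp add: bind_kernel_in_prob_algebra[OF _ Q])
qed

lemma tv_dist_upper:
  assumes "prob_space \<mu>" "prob_space \<nu>" "A \<in> sets \<mu>"
  shows "\<bar>measure \<mu> A - measure \<nu> A\<bar> \<le> tv_dist \<mu> \<nu>"
  unfolding tv_dist_def
proof (rule cSUP_upper[OF assms(3)])
  interpret \<mu>: prob_space \<mu> by fact
  interpret \<nu>: prob_space \<nu> by fact
  show "bdd_above ((\<lambda>A. \<bar>measure \<mu> A - measure \<nu> A\<bar>) ` sets \<mu>)"
  proof (rule bdd_aboveI2)
    fix A show "\<bar>measure \<mu> A - measure \<nu> A\<bar> \<le> 1"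
      using \<mu>.prob_le_1[of A] \<nu>.prob_le_1[of A] measure_nonneg[of \<mu> A] measure_nonneg[of \<nu> A]
      unfolding abs_le_iff by linarith
  qed
qed

lemma tv_dist_least:
  assumes "\<And>A. A \<in> sets \<mu> \<Longrightarrow> \<bar>measure \<mu> A - measure \<nu> A\<bar> \<le> t"
  shows "tv_dist \<mu> \<nu> \<le> t"
  unfolding tv_dist_def by (rule cSUP_least) (use assms in auto)

lemma tv_dist_nonneg:
  assumes "prob_space \<mu>" "prob_space \<nu>"
  shows "0 \<le> tv_dist \<mu> \<nu>"
  using tv_dist_upper[OF assms, of "{}"] by simp

lemma tv_dist_triangle_left:
  assumes "prob_space \<mu>" "prob_space \<nu>" "prob_space \<pi>" "sets \<mu> = sets \<nu>"
  shows "tv_dist \<mu> \<nu> \<le> tv_dist \<mu> \<pi> + tv_dist \<nu> \<pi>"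
proof (rule tv_dist_least)
  fix A assume "A \<in> sets \<mu>"
  then show "\<bar>measure \<mu> A - measure \<nu> A\<bar> \<le> tv_dist \<mu> \<pi> + tv_dist \<nu> \<pi>"
    using tv_dist_upper[of \<mu> \<pi> A] tv_dist_upper[of \<nu> \<pi> A] assms by simp
qed

text \<open>Writing \<open>g x\<close> as the length of \<open>{0..<g x}\<close> and exchanging the two integrals
  expresses an expectation through measures of sets only, which is what a total variation bound
  controls. The cut-off to \<open>u \<in> {0..1}\<close> costs nothing because \<open>g \<le> 1\<close>, and it keeps an error
  of size \<open>t\<close> at each level \<open>u\<close> integrable.\<close>

lemma nn_integral_layer_cake:
  assumes \<mu>: "prob_space \<mu>" and g[measurable]: "g \<in> borel_measurable \<mu>"
    and g01: "\<And>x. 0 \<le> g x" "\<And>x. g x \<le> (1::real)"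
  shows "(\<integral>\<^sup>+x. ennreal (g x) \<partial>\<mu>)
    = (\<integral>\<^sup>+u. emeasure \<mu> {x\<in>space \<mu>. u < g x} * indicator {0..1} u \<partial>lborel)"
proof -
  interpret prob_space \<mu> by fact
  interpret P: pair_sigma_finite \<mu> "lborel :: real measure" ..
  have "(\<integral>\<^sup>+x. ennreal (g x) \<partial>\<mu>) = (\<integral>\<^sup>+x. (\<integral>\<^sup>+u. indicator {u. 0 \<le> u \<and> u < g x} u \<partial>lborel) \<partial>\<mu>)"
  proof (rule nn_integral_cong)
    fix x
    have "{u. 0 \<le> u \<and> u < g x} = {0..<g x}" by auto
    then show "ennreal (g x) = (\<integral>\<^sup>+u. indicator {u. 0 \<le> u \<and> u < g x} u \<partial>lborel)"
      using g01(1)[of x] by simp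
  qed
  also have "\<dots> = (\<integral>\<^sup>+u. (\<integral>\<^sup>+x. indicator {u. 0 \<le> u \<and> u < g x} u \<partial>\<mu>) \<partial>lborel)"
    by (rule P.Fubini'[symmetric]) measurable
  also have "\<dots> = (\<integral>\<^sup>+u. emeasure \<mu> {x\<in>space \<mu>. u < g x} * indicator {0..1} u \<partial>lborel)"
  proof (rule nn_integral_cong)
    fix u :: real
    have "(\<integral>\<^sup>+x. indicator {u. 0 \<le> u \<and> u < g x} u \<partial>\<mu>)
        = (\<integral>\<^sup>+x. indicator {x\<in>space \<mu>. u < g x} x * indicator {0..1} u \<partial>\<mu>)"
      by (rule nn_integral_cong)
        (use g01(2) in \<open>auto split: split_indicator intro: less_imp_le order_less_le_trans\<close>)
    then show "(\<integral>\<^sup>+x. indicator {u. 0 \<le> u \<and> u < g x} u \<partial>\<mu>)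
        = emeasure \<mu> {x\<in>space \<mu>. u < g x} * indicator {0..1} u"
      by (simp add: nn_integral_multc)
  qed
  finally show ?thesis .
qed

text \<open>A bound on all events extends to all test functions with values in the unit interval, by
  comparing the superlevel sets of \<open>g\<close> in the layer cake formula. One-sided bounds in the
  extended non-negative reals avoid every question of integrability.\<close>

lemma nn_integral_le_add_of_measure_le:
  assumes \<mu>: "prob_space \<mu>" and \<nu>: "prob_space \<nu>" and sets: "sets \<mu> = sets \<nu>"
    and g[measurable]: "g \<in> borel_measurable \<nu>"
    and g01: "\<And>x. 0 \<le> g x" "\<And>x. g x \<le> (1::real)"
    and t: "\<And>A. A \<in> sets \<mu> \<Longrightarrow> measure \<mu> A \<le> measure \<nu> A + t" "0 \<le> t"
  shows "(\<integral>\<^sup>+x. ennreal (g x) \<partial>\<mu>) \<le> (\<integral>\<^sup>+x. ennreal (g x) \<partial>\<nu>) + ennreal t"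
proof -
  note [measurable_cong] = sets
  interpret \<mu>: prob_space \<mu> by fact
  interpret \<nu>: prob_space \<nu> by fact
  interpret P: pair_sigma_finite "lborel :: real measure" \<nu> ..
  have g\<mu>: "g \<in> borel_measurable \<mu>" by measurable
  have sp: "space \<mu> = space \<nu>" by (rule sets_eq_imp_space_eq[OF sets])
  have meas: "(\<lambda>u. emeasure \<nu> {x\<in>space \<nu>. u < g x}) \<in> borel_measurable (lborel :: real measure)"
    by measurable
  have "(\<integral>\<^sup>+x. ennreal (g x) \<partial>\<mu>)
      = (\<integral>\<^sup>+u. emeasure \<mu> {x\<in>space \<nu>. u < g x} * indicator {0..1} u \<partial>lborel)"
    unfolding nn_integral_layer_cake[OF \<mu> g\<mu> g01] sp ..
  also have "\<dots> \<le> (\<integral>\<^sup>+u. emeasure \<nu> {x\<in>space \<nu>. u < g x} * indicator {0..1} u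
      + ennreal t * indicator {0..1} u \<partial>lborel)"
  proof (rule nn_integral_mono)
    fix u :: real
    have A: "{x\<in>space \<nu>. u < g x} \<in> sets \<mu>" unfolding sets by measurable
    have "emeasure \<mu> {x\<in>space \<nu>. u < g x} \<le> emeasure \<nu> {x\<in>space \<nu>. u < g x} + ennreal t"
      unfolding \<mu>.emeasure_eq_measure \<nu>.emeasure_eq_measure
      using t(1)[OF A] t(2) by (simp flip: ennreal_plus)
    then show "emeasure \<mu> {x\<in>space \<nu>. u < g x} * indicator {0..1} u
        \<le> emeasure \<nu> {x\<in>space \<nu>. u < g x} * indicator {0..1} u + ennreal t * indicator {0..1} u"
      by (auto split: split_indicator)
  qed
  also have "\<dots> = (\<integral>\<^sup>+u. emeasure \<nu> {x\<in>space \<nu>. u < g x} * indicator {0..1} u \<partial>lborel) + ennreal t"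
    using meas by (subst nn_integral_add) (auto simp: nn_integral_cmult)
  also have "\<dots> = (\<integral>\<^sup>+x. ennreal (g x) \<partial>\<nu>) + ennreal t"
    unfolding nn_integral_layer_cake[OF \<nu> g g01] ..
  finally show ?thesis .
qed

text \<open>The data processing inequality: the mass that \<open>\<mu> \<bind> Q\<close> gives to \<open>A\<close> is the
  \<open>\<mu>\<close>-average of \<open>x \<mapsto> Q x A\<close>, a test function with values in the unit interval.\<close>

lemma tv_dist_bind_le:
  assumes Q: "Q \<in> M \<rightarrow>\<^sub>M prob_algebra N"
    and \<mu>: "\<mu> \<in> space (prob_algebra M)" and \<nu>: "\<nu> \<in> space (prob_algebra M)"
  shows "tv_dist (\<mu> \<bind> Q) (\<nu> \<bind> Q) \<le> tv_dist \<mu> \<nu>"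
proof (rule tv_dist_least)
  fix A assume "A \<in> sets (\<mu> \<bind> Q)"
  then have A: "A \<in> sets N" using sets_bind'[OF \<mu> Q] by simp
  have pr: "prob_space \<mu>" "prob_space \<nu>" "sets \<mu> = sets M" "sets \<nu> = sets M"
    using \<mu> \<nu> by (auto simp: space_prob_algebra)
  have one_sided: "measure (\<mu>1 \<bind> Q) A \<le> measure (\<mu>2 \<bind> Q) A + tv_dist \<mu> \<nu>"
    if \<mu>1: "\<mu>1 \<in> space (prob_algebra M)" and \<mu>2: "\<mu>2 \<in> space (prob_algebra M)"
      and le: "\<And>B. B \<in> sets M \<Longrightarrow> measure \<mu>1 B \<le> measure \<mu>2 B + tv_dist \<mu> \<nu>" for \<mu>1 \<mu>2
  proof -
    have sets [measurable_cong]: "sets \<mu>1 = sets M" "sets \<mu>2 = sets M"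
      and prob: "prob_space \<mu>1" "prob_space \<mu>2"
      using \<mu>1 \<mu>2 by (auto simp: space_prob_algebra)
    \<comment> \<open>Outside \<open>space M\<close> nothing is known about \<open>Q x\<close>, so \<open>g\<close> is cut off there to stay in the unit interval.\<close>
    define g where "g x = (if x \<in> space M then measure (Q x) A else 0)" for x
    have [measurable]: "(\<lambda>x. measure (Q x) A) \<in> borel_measurable M"
      using measurable_compose[OF Q measurable_measure_prob_algebra[OF A]] .
    have g_meas [measurable]: "g \<in> borel_measurable M"
      by (subst measurable_cong[of _ _ "\<lambda>x. measure (Q x) A"]) (auto simp: g_def)
    have prob_Q: "prob_space (Q x)" if "x \<in> space M" for x
      using measurable_space[OF Q that] by (simp add: space_prob_algebra)
    have g01: "0 \<le> g x" "g x \<le> 1" for x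
      using prob_space.prob_le_1[OF prob_Q] by (auto simp: g_def)
    have bind: "emeasure (\<mu>' \<bind> Q) A = (\<integral>\<^sup>+x. ennreal (g x) \<partial>\<mu>')"
      if \<mu>': "\<mu>' \<in> space (prob_algebra M)" for \<mu>'
    proof -
      have "space \<mu>' = space M"
        using \<mu>' by (intro sets_eq_imp_space_eq) (simp add: space_prob_algebra)
      then show ?thesis
        unfolding emeasure_bind_prob_algebra[OF \<mu>' Q A]
        by (intro nn_integral_cong)
          (simp add: g_def finite_measure.emeasure_eq_measure[OF prob_space.finite_measure[OF prob_Q]])
    qed
    have "(\<integral>\<^sup>+x. ennreal (g x) \<partial>\<mu>1) \<le> (\<integral>\<^sup>+x. ennreal (g x) \<partial>\<mu>2) + ennreal (tv_dist \<mu> \<nu>)"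
      by (rule nn_integral_le_add_of_measure_le)
        (use prob sets le g01 tv_dist_nonneg[OF pr(1,2)] in auto)
    then have "emeasure (\<mu>1 \<bind> Q) A \<le> emeasure (\<mu>2 \<bind> Q) A + ennreal (tv_dist \<mu> \<nu>)"
      by (simp add: bind \<mu>1 \<mu>2)
    then show ?thesis
      using tv_dist_nonneg[OF pr(1,2)]
        prob_space.finite_measure[OF prob_space_bind'[OF \<mu>1 Q]]
        prob_space.finite_measure[OF prob_space_bind'[OF \<mu>2 Q]]
      by (simp add: finite_measure.emeasure_eq_measure flip: ennreal_plus)
  qed
  have abs: "\<bar>measure \<mu> B - measure \<nu> B\<bar> \<le> tv_dist \<mu> \<nu>" if "B \<in> sets M" for B
    using tv_dist_upper[OF pr(1,2), of B] that pr(3) by simp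
  have "measure (\<mu> \<bind> Q) A \<le> measure (\<nu> \<bind> Q) A + tv_dist \<mu> \<nu>"
    by (rule one_sided) (use \<mu> \<nu> abs in \<open>fastforce simp: abs_le_iff\<close>)+
  moreover have "measure (\<nu> \<bind> Q) A \<le> measure (\<mu> \<bind> Q) A + tv_dist \<mu> \<nu>"
    by (rule one_sided) (use \<mu> \<nu> abs in \<open>fastforce simp: abs_le_iff\<close>)+
  ultimately show "\<bar>measure (\<mu> \<bind> Q) A - measure (\<nu> \<bind> Q) A\<bar> \<le> tv_dist \<mu> \<nu>"
    by linarith
qed

lemma tv_dist_law_after_antimono:
  assumes Q: "Q \<in> borel \<rightarrow>\<^sub>M prob_algebra borel" and "m \<le> n"
  shows "tv_dist (law_after Q y n) (law_after Q y' n) \<le> tv_dist (law_after Q y m) (law_after Q y' m)"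
  using tv_dist_bind_le[OF Q law_after_in_prob_algebra[OF Q] law_after_in_prob_algebra[OF Q]]
  by (intro lift_Suc_antimono_le[OF _ \<open>m \<le> n\<close>]) simp

lemma tv_dist_to_invariant_antimono:
  assumes Q: "Q \<in> borel \<rightarrow>\<^sub>M prob_algebra borel" and \<pi>: "invariant_law Q \<pi>" and "m \<le> n"
  shows "tv_dist (law_after Q y n) \<pi> \<le> tv_dist (law_after Q y m) \<pi>"
  using tv_dist_bind_le[OF Q law_after_in_prob_algebra[OF Q], of \<pi> y] \<pi>
  by (intro lift_Suc_antimono_le[OF _ \<open>m \<le> n\<close>]) (simp add: invariant_law_def space_prob_algebra)

section \<open>Mixing times from total variation bounds\<close>

text \<open>In the well-order \<open>enat\<close> a finite infimum is attained, so a finite mixing time is a time at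
  which the chain is within \<open>\<epsilon>\<close> of equilibrium.\<close>

lemma tv_dist_at_mixing_time:
  assumes "mixing_time z \<epsilon> Q \<pi> = enat n"
  shows "tv_dist (law_after Q z n) \<pi> \<le> \<epsilon>"
proof -
  let ?S = "enat ` {n. tv_dist (law_after Q z n) \<pi> \<le> \<epsilon>}"
  have Inf: "Inf ?S = enat n" using assms by (simp add: mixing_time_def)
  then have "?S \<noteq> {}" by (metis Inf_enat_def enat.distinct(1) infinity_enat_def)
  then obtain m where "m \<in> ?S" by blast
  then have "Inf ?S \<in> ?S" by (metis Inf_enat_def LeastI empty_iff)
  then show ?thesis unfolding Inf by auto
qed

lemma mixing_time_greater:
  assumes "\<And>n. int n \<le> m \<Longrightarrow> \<epsilon> < tv_dist (law_after Q z n) \<pi>"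
  shows "ereal (of_int m) < ereal_of_enat (mixing_time z \<epsilon> Q \<pi>)"
proof (cases "mixing_time z \<epsilon> Q \<pi>")
  case (enat n)
  then have "\<not> int n \<le> m"
    using assms[of n] tv_dist_at_mixing_time[OF enat] by linarith
  then have "of_int m < real n" by linarith
  then show ?thesis using enat by simp
qed simp

text \<open>If the distance between two copies of the chain decays no faster than \<open>e\<^sup>-\<^sup>a\<^sup>n\<close>,
  both copies cannot be close to the invariant law before that distance is small. The limit
  hypothesis yields the lower bound \<open>T n \<ge> e\<^sup>-\<^sup>a\<^sup>n\<close> only from some index \<open>N\<close> on; monotonicity of
  total variation supplies \<open>T n \<ge> T N > 0\<close> before \<open>N\<close>, and \<open>c = min 1 (T N)\<close> covers both ranges.
  At the later of the two mixing times, monotonicity again and the triangle inequality give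
  \<open>c e\<^sup>-\<^sup>a\<^sup>n \<le> T n \<le> 2\<epsilon>\<close>, so the initial state that mixes later is the slow one.\<close>

lemma mixing_time_of_tv_rate:
  assumes Q: "Q \<in> borel \<rightarrow>\<^sub>M prob_algebra borel" and \<pi>: "invariant_law Q \<pi>"
    and lim: "(\<lambda>n. root n (tv_dist (law_after Q y n) (law_after Q y' n))) \<longlonglongrightarrow> \<rho>"
    and a: "0 < a" "exp (- a) < \<rho>"
  shows "\<exists>c>0. \<forall>\<epsilon>\<in>{0<..c / 4}. \<exists>z\<in>{y, y'}.
    ereal (ln (c / (4 * \<epsilon>)) / a - 1) \<le> ereal_of_enat (mixing_time z \<epsilon> Q \<pi>)"
proof -
  define T where "T n = tv_dist (law_after Q y n) (law_after Q y' n)" for n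
  have pr: "prob_space (law_after Q z n)" "sets (law_after Q z n) = sets borel" for z n
    using law_after_in_prob_algebra[OF Q, of z n] by (auto simp: space_prob_algebra)
  have pr\<pi>: "prob_space \<pi>" using \<pi> by (simp add: invariant_law_def)
  have T_nonneg: "0 \<le> T n" for n unfolding T_def by (rule tv_dist_nonneg[OF pr(1) pr(1)])
  have T_anti: "T n \<le> T m" if "m \<le> n" for m n
    unfolding T_def by (rule tv_dist_law_after_antimono[OF Q that])
  have "\<forall>\<^sub>F n in sequentially. exp (- a) < root n (T n)"
    unfolding T_def using order_tendstoD(1)[OF lim a(2)] .
  then obtain N where N: "\<And>n. N \<le> n \<Longrightarrow> exp (- a) < root n (T n)"
    unfolding eventually_sequentially by blast
  have late: "exp (- a * real n) \<le> T n" if "N \<le> n" for n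
  proof (cases "n = 0")
    case True
    then show ?thesis using N[OF that] exp_gt_zero[of "- a"] by simp
  next
    case False
    have "exp (- a * real n) = exp (- a) ^ n" by (simp add: mult.commute flip: exp_of_nat_mult)
    also have "\<dots> \<le> root n (T n) ^ n" using N[OF that] by (intro power_mono) auto
    also have "\<dots> = T n" using False T_nonneg by (simp add: real_root_pow_pos2)
    finally show ?thesis .
  qed
  define c where "c = min 1 (T N)"
  have "0 < T N" using late[of N] exp_gt_zero[of "- a * real N"] by linarith
  then have c: "0 < c" by (simp add: c_def)
  have lower: "c * exp (- a * real n) \<le> T n" for n
  proof (cases "N \<le> n")
    case True
    have "c * exp (- a * real n) \<le> 1 * exp (- a * real n)"
      by (intro mult_right_mono) (auto simp: c_def)
    then show ?thesis using late[OF True] by linarith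
  next
    case False
    have "c * exp (- a * real n) \<le> T N * 1"
      using a(1) T_nonneg by (intro mult_mono) (auto simp: c_def)
    also have "\<dots> \<le> T n" using T_anti[of n N] False by simp
    finally show ?thesis .
  qed
  have "\<exists>z\<in>{y, y'}. ereal (ln (c / (4 * \<epsilon>)) / a - 1) \<le> ereal_of_enat (mixing_time z \<epsilon> Q \<pi>)"
    if \<epsilon>: "0 < \<epsilon>" for \<epsilon>
  proof (cases "mixing_time y \<epsilon> Q \<pi> = \<infinity> \<or> mixing_time y' \<epsilon> Q \<pi> = \<infinity>")
    case True
    then show ?thesis by auto
  next
    case False
    then obtain n1 n2 where n: "mixing_time y \<epsilon> Q \<pi> = enat n1" "mixing_time y' \<epsilon> Q \<pi> = enat n2"
      by auto
    define n where "n = max n1 n2"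
    have "tv_dist (law_after Q y n) \<pi> \<le> \<epsilon>"
      using tv_dist_to_invariant_antimono[OF Q \<pi>, of n1 n y] tv_dist_at_mixing_time[OF n(1)]
      by (simp add: n_def)
    moreover have "tv_dist (law_after Q y' n) \<pi> \<le> \<epsilon>"
      using tv_dist_to_invariant_antimono[OF Q \<pi>, of n2 n y'] tv_dist_at_mixing_time[OF n(2)]
      by (simp add: n_def)
    ultimately have "T n \<le> 2 * \<epsilon>"
      using tv_dist_triangle_left[OF pr(1) pr(1) pr\<pi>, of y n y' n] pr(2) by (simp add: T_def)
    then have "c * exp (- a * real n) \<le> 4 * \<epsilon>" using lower[of n] \<epsilon> by linarith
    then have "c / (4 * \<epsilon>) \<le> exp (a * real n)"
      using \<epsilon> by (simp add: exp_minus field_simps)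
    then have "ln (c / (4 * \<epsilon>)) \<le> a * real n"
      using c \<epsilon> by (metis exp_gt_zero ln_exp ln_le_cancel_iff zero_less_divide_iff zero_less_mult_iff zero_less_numeral)
    then have "ln (c / (4 * \<epsilon>)) / a \<le> real n" using a(1) by (simp add: field_simps)
    then have "ereal (ln (c / (4 * \<epsilon>)) / a - 1) \<le> ereal (real n)" by simp
    moreover have "n = n1 \<or> n = n2" by (auto simp: n_def max_def)
    ultimately show ?thesis using n by auto
  qed
  then show ?thesis using c by (intro exI[of _ c]) auto
qed

text \<open>This converts the rate \<open>q\<close>, where \<open>x = C / \<kappa>\<close>, into an exponential rate. To first order in
  \<open>x\<close> the right-hand side is \<open>e\<^sup>-\<^sup>2\<^sup>x\<close>, and the constant 3 leaves enough room for all \<open>x \<le> 1/2\<close>: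
  the second-order Taylor polynomial of \<open>e\<^sup>3\<^sup>x\<close> already suffices.\<close>

lemma exp_neg_three_less_ratio:
  fixes x :: real
  assumes "0 < x" "x \<le> 1 / 2"
  shows "exp (- (3 * x)) < (1 - x) / (1 + x)"
proof -
  have "0 < x * (1 + 3 / 2 * x - 9 / 2 * (x * x))"
  proof (rule mult_pos_pos)
    have "x * x \<le> 1 / 2 * x" using assms by (intro mult_right_mono) auto
    then show "0 < 1 + 3 / 2 * x - 9 / 2 * (x * x)" using assms by linarith
  qed fact
  then have "1 + x < (1 - x) * (1 + 3 * x + (3 * x)\<^sup>2 / 2)"
    by (simp add: field_simps power2_eq_square)
  also have "\<dots> \<le> (1 - x) * exp (3 * x)"
    using assms by (intro mult_left_mono exp_lower_Taylor_quadratic) auto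
  finally show ?thesis using assms by (simp add: exp_minus field_simps)
qed

section \<open>Uniqueness of the invariant law of a contracting chain\<close>

text \<open>Closed sets generate the Borel sets and are stable under intersection, and the indicator of
  a closed set \<open>C\<close> is the pointwise limit of the bounded Lipschitz functions
  \<open>max 0 (1 - n * infdist x C)\<close>.\<close>

lemma measure_eqI_lipschitz:
  fixes \<mu> \<nu> :: "'s::metric_space measure"
  assumes \<mu>: "prob_space \<mu>" "sets \<mu> = sets borel" and \<nu>: "prob_space \<nu>" "sets \<nu> = sets borel"
    and eq: "\<And>f L. (\<And>x. \<bar>f x\<bar> \<le> 1) \<Longrightarrow> (\<And>x y. \<bar>f x - f y\<bar> \<le> L * dist x y) \<Longrightarrow> 0 \<le> L
      \<Longrightarrow> (\<integral>x. f x \<partial>\<mu>) = (\<integral>x. f x \<partial>\<nu> :: real)"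
  shows "\<mu> = \<nu>"
proof (rule measure_eqI_generator_eq[where E="Collect closed" and \<Omega>=UNIV and A="\<lambda>_. UNIV"])
  interpret \<mu>: prob_space \<mu> by fact
  interpret \<nu>: prob_space \<nu> by fact
  show "Int_stable (Collect closed :: 's set set)" by (auto simp: Int_stable_def)
  show "sets \<mu> = sigma_sets UNIV (Collect closed)" "sets \<nu> = sigma_sets UNIV (Collect closed)"
    unfolding \<mu> \<nu> by (simp_all add: borel_eq_closed)
  fix C :: "'s set" assume "C \<in> Collect closed"
  then have C: "closed C" by simp
  show "emeasure \<mu> C = emeasure \<nu> C"
  proof (cases "C = {}")
    case False
    define f where "f n x = max 0 (1 - real n * infdist x C)" for n x
    have f01: "\<bar>f n x\<bar> \<le> 1" for n x by (auto simp: f_def infdist_nonneg)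
    have f_lip: "\<bar>f n x - f n y\<bar> \<le> real n * dist x y" for n x y
    proof -
      have "\<bar>f n x - f n y\<bar> \<le> \<bar>real n * infdist x C - real n * infdist y C\<bar>"
        unfolding f_def by linarith
      also have "\<dots> = real n * \<bar>infdist x C - infdist y C\<bar>"
        by (simp add: abs_mult flip: right_diff_distrib)
      also have "\<dots> \<le> real n * dist x y"
        by (intro mult_left_mono infdist_triangle_abs) auto
      finally show ?thesis .
    qed
    have f_cont: "continuous_on UNIV (f n)" for n
      unfolding f_def by (intro continuous_intros)
    have f_meas: "f n \<in> borel_measurable borel" for n
      using borel_measurable_continuous_onI[OF f_cont] .
    have f_lim: "(\<lambda>n. f n x) \<longlonglongrightarrow> indicator C x" for x
    proof (cases "x \<in> C")
      case True
      then show ?thesis by (simp add: f_def)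
    next
      case x: False
      then have pos: "0 < infdist x C" using infdist_pos_not_in_closed[OF C False] by simp
      obtain N where N: "1 / infdist x C < real N" using reals_Archimedean2 by blast
      have "f n x = 0" if "N \<le> n" for n
      proof -
        have "1 < real N * infdist x C" using N pos by (simp add: field_simps)
        also have "\<dots> \<le> real n * infdist x C" using that pos by simp
        finally show ?thesis by (simp add: f_def)
      qed
      then have "\<forall>\<^sub>F n in sequentially. f n x = indicator C x"
        using x by (auto simp: eventually_sequentially)
      then show ?thesis by (rule tendsto_eventually)
    qed
    have lim: "(\<lambda>n. \<integral>x. f n x \<partial>M) \<longlonglongrightarrow> measure M C" if M: "prob_space M" "sets M = sets borel" for M
    proof -
      interpret prob_space M by fact
      note [measurable_cong] = M(2)
      have "(\<lambda>n. \<integral>x. f n x \<partial>M) \<longlonglongrightarrow> (\<integral>x. indicator C x \<partial>M)"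
        by (rule integral_dominated_convergence[where w="\<lambda>_. 1"])
          (use f_meas C f_lim f01 measurable_cong_sets[OF M(2) refl] in \<open>auto intro!: borel_measurable_indicator\<close>)
      then show ?thesis using C M by simp
    qed
    have "measure \<mu> C = measure \<nu> C"
      by (rule LIMSEQ_unique[OF lim[OF \<mu>]]) (use lim[OF \<nu>] eq[OF f01 f_lip] in simp)
    then show ?thesis by (simp add: \<mu>.emeasure_eq_measure \<nu>.emeasure_eq_measure)
  qed simp
next
  interpret prob_space \<mu> by fact
  show "emeasure \<mu> UNIV \<noteq> \<infinity>" using emeasure_finite by simp
qed auto

text \<open>Two copies of the chain driven by the same noise \<open>\<xi>\<close> approach each other geometrically.
  Hence the Markov operator \<open>P\<close> multiplies Lipschitz constants by \<open>k\<close>, and the iterates of \<open>P\<close> on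
  a bounded Lipschitz \<open>f\<close> become constant in the limit. As an invariant law \<open>q\<close> gives \<open>f\<close> and each
  of its iterates the same mean, the values \<open>(P ^^ n) f z\<close> at any one point \<open>z\<close> converge to
  \<open>\<integral>x. f x \<partial>q\<close>, a limit that determines \<open>q\<close>. The chain need only contract in some function \<open>D\<close>
  comparable to the metric, because a kinetic chain contracts in an energy distance but in general
  not in the Euclidean one.\<close>

lemma invariant_law_unique_of_contraction:
  fixes T :: "'s::metric_space \<Rightarrow> 'x \<Rightarrow> 's"
  assumes N: "prob_space N" and T: "(\<lambda>(z, \<xi>). T z \<xi>) \<in> borel \<Otimes>\<^sub>M N \<rightarrow>\<^sub>M borel"
    and Q: "Q = (\<lambda>z. distr N borel (T z))"
    and D1: "\<And>x y. dist x y \<le> c1 * D x y" and D2: "\<And>x y. D x y \<le> c2 * dist x y"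
    and c: "0 \<le> c1" "0 \<le> c2"
    and contr: "\<And>z z' \<xi>. D (T z \<xi>) (T z' \<xi>) \<le> k * D z z'" and k: "0 \<le> k" "k < 1"
    and p: "invariant_law Q p" and p': "invariant_law Q p'"
  shows "p = p'"
proof (rule measure_eqI_lipschitz)
  show "prob_space p" "sets p = sets borel" "prob_space p'" "sets p' = sets borel"
    using p p' by (auto simp: invariant_law_def)
  fix f :: "'s \<Rightarrow> real" and L
  assume f1: "\<And>x. \<bar>f x\<bar> \<le> 1" and fL: "\<And>x y. \<bar>f x - f y\<bar> \<le> L * dist x y" and L: "0 \<le> L"
  interpret N: prob_space N by fact
  note [measurable] = T
  have Q_meas: "Q \<in> borel \<rightarrow>\<^sub>M prob_algebra borel"
    unfolding Q by (rule measurable_distr_prob_space2[OF _ T]) (simp add: space_prob_algebra N)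
  define P where "P g z = (\<integral>\<xi>. g (T z \<xi>) \<partial>N)" for g :: "'s \<Rightarrow> real" and z
  have lip_meas: "g \<in> borel_measurable borel"
    if "\<And>x y. \<bar>g x - g y\<bar> \<le> K * D x y" "0 \<le> K" for g :: "'s \<Rightarrow> real" and K
  proof -
    have "(K * c2)-lipschitz_on UNIV g"
    proof (rule lipschitz_onI)
      fix x y
      have "\<bar>g x - g y\<bar> \<le> K * (c2 * dist x y)"
        using that(1)[of x y] mult_left_mono[OF D2[of x y] that(2)] by linarith
      then show "dist (g x) (g y) \<le> K * c2 * dist x y" by (simp add: dist_real_def mult.assoc)
    qed (use that c in auto)
    then show ?thesis by (intro borel_measurable_continuous_onI lipschitz_on_continuous_on)
  qed
  have Pn: "(\<forall>x. \<bar>(P ^^ n) f x\<bar> \<le> 1) \<and> (\<forall>x y. \<bar>(P ^^ n) f x - (P ^^ n) f y\<bar> \<le> (L * c1 * k ^ n) * D x y)" for n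
  proof (induction n)
    case 0
    have "\<bar>f x - f y\<bar> \<le> L * c1 * D x y" for x y
      using fL[of x y] mult_left_mono[OF D1[of x y] L] by (simp add: mult.assoc)
    then show ?case using f1 by simp
  next
    case (Suc n)
    define g where "g = (P ^^ n) f"
    define K where "K = L * c1 * k ^ n"
    have K: "0 \<le> K" using L c k by (simp add: K_def)
    have g: "\<And>x. \<bar>g x\<bar> \<le> 1" "\<And>x y. \<bar>g x - g y\<bar> \<le> K * D x y"
      using Suc by (auto simp: g_def K_def)
    have [measurable]: "g \<in> borel_measurable borel" using lip_meas[OF g(2) K] .
    have int: "integrable N (\<lambda>\<xi>. g (T z \<xi>))" for z
      by (rule N.integrable_const_bound[of _ 1]) (use g(1) in auto)
    have "\<bar>P g z\<bar> \<le> 1" for z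
    proof -
      have "\<bar>P g z\<bar> \<le> (\<integral>\<xi>. \<bar>g (T z \<xi>)\<bar> \<partial>N)" unfolding P_def by (rule integral_abs_bound)
      also have "\<dots> \<le> 1" using int g(1) by (intro N.integral_le_const) auto
      finally show ?thesis .
    qed
    moreover have "\<bar>P g x - P g y\<bar> \<le> K * k * D x y" for x y
    proof -
      have "\<bar>P g x - P g y\<bar> = \<bar>\<integral>\<xi>. g (T x \<xi>) - g (T y \<xi>) \<partial>N\<bar>"
        unfolding P_def using int by simp
      also have "\<dots> \<le> (\<integral>\<xi>. \<bar>g (T x \<xi>) - g (T y \<xi>)\<bar> \<partial>N)" by (rule integral_abs_bound)
      also have "\<dots> \<le> K * k * D x y"
      proof (rule N.integral_le_const)
        show "integrable N (\<lambda>\<xi>. \<bar>g (T x \<xi>) - g (T y \<xi>)\<bar>)" using int by simp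
        show "AE \<xi> in N. \<bar>g (T x \<xi>) - g (T y \<xi>)\<bar> \<le> K * k * D x y"
          using g(2) mult_left_mono[OF contr K] by (intro AE_I2) (metis mult.assoc order_trans)
      qed
      finally show ?thesis .
    qed
    ultimately show ?case by (simp add: g_def K_def mult_ac)
  qed
  have Pn_meas: "(P ^^ n) f \<in> borel_measurable borel" for n
    by (rule lip_meas[of _ "L * c1 * k ^ n"]) (use Pn L c k in auto)
  have lim: "(\<lambda>n. (P ^^ n) f z) \<longlonglongrightarrow> (\<integral>x. f x \<partial>q)" if q: "invariant_law Q q" for q z
  proof -
    interpret q: prob_space q using q by (simp add: invariant_law_def)
    have [measurable_cong]: "sets q = sets borel" using q by (simp add: invariant_law_def)
    have meas: "(P ^^ n) f \<in> borel_measurable q" for n using Pn_meas[of n] by measurable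
    have int: "integrable q ((P ^^ n) f)" for n
      by (rule q.integrable_const_bound[of _ 1]) (use Pn meas in auto)
    have pres: "(\<integral>x. (P ^^ n) f x \<partial>q) = (\<integral>x. f x \<partial>q)" for n
    proof (induction n)
      case (Suc n)
      have [measurable]: "(P ^^ n) f \<in> borel_measurable borel" by (rule Pn_meas)
      have Qq: "Q \<in> q \<rightarrow>\<^sub>M subprob_algebra borel"
        using measurable_prob_algebraD[OF Q_meas] by measurable
      have "(\<integral>x. (P ^^ n) f x \<partial>q) = (\<integral>x. (P ^^ n) f x \<partial>(q \<bind> Q))"
        using q by (simp add: invariant_law_def)
      also have "\<dots> = (\<integral>z. (\<integral>x. (P ^^ n) f x \<partial>Q z) \<partial>q)"
      proof (rule integral_bind[OF _ _ Qq, where B=1 and B'=1])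
        show "AE x in q. emeasure (Q x) (space (Q x)) \<le> ennreal 1"
          using measurable_space[OF Q_meas] by (intro AE_I2) (simp add: space_prob_algebra prob_space.emeasure_space_1)
      qed (use Pn q.finite_measure_axioms in auto)
      also have "\<dots> = (\<integral>z. P ((P ^^ n) f) z \<partial>q)"
      proof (rule Bochner_Integration.integral_cong[OF refl])
        fix z
        show "(\<integral>x. (P ^^ n) f x \<partial>Q z) = P ((P ^^ n) f) z"
          unfolding Q P_def[of "(P ^^ n) f"] by (rule integral_distr) measurable
      qed
      finally show ?case using Suc by simp
    qed simp
    have "(\<lambda>n. \<integral>x. (P ^^ n) f x - (P ^^ n) f z \<partial>q) \<longlonglongrightarrow> (\<integral>x. 0 \<partial>q)"
    proof (rule integral_dominated_convergence[where w="\<lambda>_. 2"])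
      show "AE x in q. (\<lambda>n. (P ^^ n) f x - (P ^^ n) f z) \<longlonglongrightarrow> 0"
      proof (rule AE_I2)
        fix x
        show "(\<lambda>n. (P ^^ n) f x - (P ^^ n) f z) \<longlonglongrightarrow> 0"
        proof (rule Lim_null_comparison)
          show "\<forall>\<^sub>F n in sequentially. norm ((P ^^ n) f x - (P ^^ n) f z) \<le> (L * c1 * k ^ n) * D x z"
            by (rule always_eventually) (simp only: real_norm_def Pn simp_thms)
          have "(\<lambda>n. (L * c1 * k ^ n) * D x z) \<longlonglongrightarrow> (L * c1 * 0) * D x z"
            using k by (intro tendsto_intros LIMSEQ_realpow_zero) auto
          then show "(\<lambda>n. (L * c1 * k ^ n) * D x z) \<longlonglongrightarrow> 0" by simp
        qed
      qed
      show "AE x in q. norm ((P ^^ n) f x - (P ^^ n) f z) \<le> 2" for n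
      proof (rule AE_I2)
        fix x
        have "\<bar>(P ^^ n) f x\<bar> \<le> 1" "\<bar>(P ^^ n) f z\<bar> \<le> 1" using Pn[of n] by blast+
        then show "norm ((P ^^ n) f x - (P ^^ n) f z) \<le> 2" by (simp add: abs_le_iff)
      qed
    qed (use meas in auto)
    then have "(\<lambda>n. (\<integral>x. f x \<partial>q) - (P ^^ n) f z) \<longlonglongrightarrow> 0"
      using int pres by (simp add: q.prob_space)
    then have "(\<lambda>n. (\<integral>x. f x \<partial>q) - ((\<integral>x. f x \<partial>q) - (P ^^ n) f z)) \<longlonglongrightarrow> (\<integral>x. f x \<partial>q) - 0"
      by (intro tendsto_diff tendsto_const)
    then show ?thesis by simp
  qed
  show "(\<integral>x. f x \<partial>p) = (\<integral>x. f x \<partial>p')"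
    using LIMSEQ_unique[OF lim[OF p, of undefined] lim[OF p']] .
qed

section \<open>Rotation invariance of the standard Gaussian\<close>

lemma norm_rotation:
  fixes x y :: "'a::real_inner"
  assumes "a\<^sup>2 + b\<^sup>2 = 1"
  shows "(norm (a *\<^sub>R x + b *\<^sub>R y))\<^sup>2 + (norm (a *\<^sub>R y - b *\<^sub>R x))\<^sup>2 = (norm x)\<^sup>2 + (norm y)\<^sup>2"
proof -
  have "(norm (a *\<^sub>R x + b *\<^sub>R y))\<^sup>2 + (norm (a *\<^sub>R y - b *\<^sub>R x))\<^sup>2
      = (a\<^sup>2 + b\<^sup>2) * ((norm x)\<^sup>2 + (norm y)\<^sup>2)"
    unfolding power2_norm_eq_inner
    by (simp add: inner_add_left inner_add_right inner_diff_left inner_diff_right inner_commute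
        power2_eq_square algebra_simps)
  then show ?thesis using assms by simp
qed

lemma prod_std_normal_density:
  fixes x :: "'a::euclidean_space"
  shows "(\<Prod>b\<in>Basis. std_normal_density (x \<bullet> b))
    = (1 / sqrt (2 * pi)) ^ DIM('a) * exp (- (norm x)\<^sup>2 / 2)"
proof -
  have "(\<Prod>b\<in>Basis. std_normal_density (x \<bullet> b))
      = (1 / sqrt (2 * pi)) ^ DIM('a) * exp (\<Sum>b\<in>(Basis::'a set). - (x \<bullet> b)\<^sup>2 / 2)"
    by (simp add: std_normal_density_def prod.distrib exp_sum prod_dividef power_divide)
  also have "(\<Sum>b\<in>(Basis::'a set). - (x \<bullet> b)\<^sup>2 / 2) = - (norm x)\<^sup>2 / 2"
    unfolding power2_norm_eq_inner euclidean_inner[of x x]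
    by (simp add: sum_negf power2_eq_square flip: sum_divide_distrib)
  finally show ?thesis .
qed

lemma sets_std_gaussian [simp, measurable_cong]: "sets std_gaussian = sets borel"
  by (simp add: std_gaussian_def)

lemma space_std_gaussian [simp]: "space std_gaussian = UNIV"
  by (simp add: std_gaussian_def)

lemma prob_space_std_gaussian: "prob_space (std_gaussian :: 'a::euclidean_space measure)"
proof (rule prob_spaceI)
  have "(\<integral>\<^sup>+x. ennreal (std_normal_density x) \<partial>lborel) = 1"
    using prob_space.emeasure_space_1[OF prob_space_normal_density[of 1 0]]
    by (simp add: emeasure_density)
  then show "emeasure (std_gaussian :: 'a measure) (space std_gaussian) = 1"
    using nn_integral_lborel_prod[where f="\<lambda>(_::'a). std_normal_density"]
    by (simp add: std_gaussian_def emeasure_density prod_ennreal)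
qed

lemma nn_integral_lborel_translate:
  assumes [measurable]: "f \<in> borel_measurable borel"
  shows "(\<integral>\<^sup>+x. f (x + c) \<partial>lborel) = (\<integral>\<^sup>+x. f x \<partial>(lborel :: 'a::euclidean_space measure))"
proof -
  have "(\<integral>\<^sup>+x. f x \<partial>lborel) = (\<integral>\<^sup>+x. f x \<partial>distr lborel borel ((+) c))"
    by (simp add: lborel_distr_plus)
  also have "\<dots> = (\<integral>\<^sup>+x. f (x + c) \<partial>lborel)"
    by (subst nn_integral_distr) (simp_all add: add.commute)
  finally show ?thesis ..
qed

text \<open>For each fixed value of the coordinate that does not move, a shear is a translation of the
  other one.\<close>

lemma nn_integral_lborel_shear:
  fixes f :: "'a::euclidean_space \<Rightarrow> 'a \<Rightarrow> ennreal"
  assumes [measurable]: "(\<lambda>(x, y). f x y) \<in> borel_measurable (borel \<Otimes>\<^sub>M borel)"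
  shows nn_integral_lborel_shear_fst:
      "(\<integral>\<^sup>+x. \<integral>\<^sup>+y. f (x + t *\<^sub>R y) y \<partial>lborel \<partial>lborel) = (\<integral>\<^sup>+x. \<integral>\<^sup>+y. f x y \<partial>lborel \<partial>lborel)"
    and nn_integral_lborel_shear_snd:
      "(\<integral>\<^sup>+x. \<integral>\<^sup>+y. f x (y + t *\<^sub>R x) \<partial>lborel \<partial>lborel) = (\<integral>\<^sup>+x. \<integral>\<^sup>+y. f x y \<partial>lborel \<partial>lborel)"
proof -
  show "(\<integral>\<^sup>+x. \<integral>\<^sup>+y. f x (y + t *\<^sub>R x) \<partial>lborel \<partial>lborel) = (\<integral>\<^sup>+x. \<integral>\<^sup>+y. f x y \<partial>lborel \<partial>lborel)"
    by (intro nn_integral_cong nn_integral_lborel_translate) measurable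
  have "(\<integral>\<^sup>+x. \<integral>\<^sup>+y. f (x + t *\<^sub>R y) y \<partial>lborel \<partial>lborel)
      = (\<integral>\<^sup>+y. \<integral>\<^sup>+x. f (x + t *\<^sub>R y) y \<partial>lborel \<partial>lborel)"
    by (rule lborel_pair.Fubini'[symmetric]) measurable
  also have "\<dots> = (\<integral>\<^sup>+y. \<integral>\<^sup>+x. f x y \<partial>lborel \<partial>lborel)"
    by (intro nn_integral_cong nn_integral_lborel_translate[of "\<lambda>x. f x _"]) measurable
  also have "\<dots> = (\<integral>\<^sup>+x. \<integral>\<^sup>+y. f x y \<partial>lborel \<partial>lborel)"
    by (rule lborel_pair.Fubini') measurable
  finally show "(\<integral>\<^sup>+x. \<integral>\<^sup>+y. f (x + t *\<^sub>R y) y \<partial>lborel \<partial>lborel) = (\<integral>\<^sup>+x. \<integral>\<^sup>+y. f x y \<partial>lborel \<partial>lborel)" .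
qed

text \<open>A rotation by an angle \<open>\<theta>\<close> with \<open>b = sin \<theta> \<noteq> 0\<close> is a product of three shears, whose
  parameters are \<open>t\<close>, \<open>-b\<close>, \<open>t\<close> with \<open>t = (1 - a) / b = tan (\<theta> / 2)\<close>. So the invariance of
  Lebesgue measure reduces to that under shears.\<close>

lemma nn_integral_lborel_rotation:
  fixes f :: "'a::euclidean_space \<Rightarrow> 'a \<Rightarrow> ennreal"
  assumes f [measurable]: "(\<lambda>(x, y). f x y) \<in> borel_measurable (borel \<Otimes>\<^sub>M borel)"
    and ab: "a\<^sup>2 + b\<^sup>2 = 1" "b \<noteq> 0"
  shows "(\<integral>\<^sup>+x. \<integral>\<^sup>+y. f (a *\<^sub>R x + b *\<^sub>R y) (a *\<^sub>R y - b *\<^sub>R x) \<partial>lborel \<partial>lborel)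
    = (\<integral>\<^sup>+x. \<integral>\<^sup>+y. f x y \<partial>lborel \<partial>lborel)"
proof -
  define t where "t = (1 - a) / b"
  define f1 where "f1 x y = f (x + t *\<^sub>R y) y" for x y
  define f2 where "f2 x y = f1 x (y + (- b) *\<^sub>R x)" for x y
  have tb: "t * b = 1 - a" using ab(2) by (simp add: t_def)
  have ta: "t + t * a = b"
    using ab by (simp add: t_def field_simps power2_eq_square)
  have rot: "f (a *\<^sub>R x + b *\<^sub>R y) (a *\<^sub>R y - b *\<^sub>R x) = f2 (x + t *\<^sub>R y) y" for x y
  proof -
    have 1: "y + (- b) *\<^sub>R (x + t *\<^sub>R y) = a *\<^sub>R y - b *\<^sub>R x"
    proof -
      have "y + (- b) *\<^sub>R (x + t *\<^sub>R y) = (1 - t * b) *\<^sub>R y - b *\<^sub>R x"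
        by (simp add: algebra_simps)
      then show ?thesis by (simp add: tb)
    qed
    have "(x + t *\<^sub>R y) + t *\<^sub>R (a *\<^sub>R y - b *\<^sub>R x) = (1 - t * b) *\<^sub>R x + (t + t * a) *\<^sub>R y"
      by (simp add: algebra_simps)
    then have 2: "(x + t *\<^sub>R y) + t *\<^sub>R (a *\<^sub>R y - b *\<^sub>R x) = a *\<^sub>R x + b *\<^sub>R y"
      by (simp only: tb ta) simp
    show ?thesis unfolding f2_def f1_def 1 2 ..
  qed
  have m1 [measurable]: "(\<lambda>(x, y). f1 x y) \<in> borel_measurable (borel \<Otimes>\<^sub>M borel)"
    unfolding f1_def by measurable
  have m2 [measurable]: "(\<lambda>(x, y). f2 x y) \<in> borel_measurable (borel \<Otimes>\<^sub>M borel)"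
    unfolding f2_def by measurable
  have "(\<integral>\<^sup>+x. \<integral>\<^sup>+y. f (a *\<^sub>R x + b *\<^sub>R y) (a *\<^sub>R y - b *\<^sub>R x) \<partial>lborel \<partial>lborel)
      = (\<integral>\<^sup>+x. \<integral>\<^sup>+y. f2 x y \<partial>lborel \<partial>lborel)"
    unfolding rot by (rule nn_integral_lborel_shear_fst[OF m2])
  also have "\<dots> = (\<integral>\<^sup>+x. \<integral>\<^sup>+y. f1 x y \<partial>lborel \<partial>lborel)"
    unfolding f2_def by (rule nn_integral_lborel_shear_snd[OF m1])
  also have "\<dots> = (\<integral>\<^sup>+x. \<integral>\<^sup>+y. f x y \<partial>lborel \<partial>lborel)"
    unfolding f1_def by (rule nn_integral_lborel_shear_fst[OF f])
  finally show ?thesis .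
qed

text \<open>The joint density of two independent standard Gaussian vectors depends on the sum of their
  squared norms only, which a rotation preserves.\<close>

lemma nn_integral_std_gaussian_rotation:
  fixes f :: "'a::euclidean_space \<Rightarrow> 'a \<Rightarrow> ennreal"
  assumes f [measurable]: "(\<lambda>(x, y). f x y) \<in> borel_measurable (borel \<Otimes>\<^sub>M borel)"
    and ab: "a\<^sup>2 + b\<^sup>2 = 1" "b \<noteq> 0"
  shows "(\<integral>\<^sup>+x. \<integral>\<^sup>+y. f (a *\<^sub>R x + b *\<^sub>R y) (a *\<^sub>R y - b *\<^sub>R x) \<partial>std_gaussian \<partial>std_gaussian)
    = (\<integral>\<^sup>+x. \<integral>\<^sup>+y. f x y \<partial>std_gaussian \<partial>std_gaussian)"
proof -
  define \<phi> where "\<phi> x = (\<Prod>b\<in>Basis. std_normal_density (x \<bullet> b))" for x :: 'a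
  have \<phi>_nonneg: "0 \<le> \<phi> x" for x by (auto simp: \<phi>_def intro!: prod_nonneg)
  have [measurable]: "\<phi> \<in> borel_measurable borel" unfolding \<phi>_def by measurable
  have pair: "(\<integral>\<^sup>+x. \<integral>\<^sup>+y. g x y \<partial>std_gaussian \<partial>std_gaussian)
      = (\<integral>\<^sup>+x. \<integral>\<^sup>+y. ennreal (\<phi> x * \<phi> y) * g x y \<partial>lborel \<partial>lborel)"
    if [measurable]: "(\<lambda>(x, y). g x y) \<in> borel_measurable (borel \<Otimes>\<^sub>M borel)" for g :: "'a \<Rightarrow> 'a \<Rightarrow> ennreal"
  proof -
    have G: "std_gaussian = density lborel (\<lambda>x. ennreal (\<phi> x))"
      by (simp add: std_gaussian_def \<phi>_def)
    have "(\<integral>\<^sup>+x. \<integral>\<^sup>+y. g x y \<partial>std_gaussian \<partial>std_gaussian)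
        = (\<integral>\<^sup>+x. ennreal (\<phi> x) * (\<integral>\<^sup>+y. ennreal (\<phi> y) * g x y \<partial>lborel) \<partial>lborel)"
      unfolding G by (simp add: nn_integral_density)
    also have "\<dots> = (\<integral>\<^sup>+x. \<integral>\<^sup>+y. ennreal (\<phi> x * \<phi> y) * g x y \<partial>lborel \<partial>lborel)"
      by (simp add: \<phi>_nonneg ennreal_mult mult.assoc nn_integral_cmult)
    finally show ?thesis .
  qed
  have inv: "\<phi> (a *\<^sub>R x + b *\<^sub>R y) * \<phi> (a *\<^sub>R y - b *\<^sub>R x) = \<phi> x * \<phi> y" for x y
  proof -
    have prod: "\<phi> u * \<phi> w = ((1 / sqrt (2 * pi)) ^ DIM('a))\<^sup>2 * exp (- ((norm u)\<^sup>2 + (norm w)\<^sup>2) / 2)" for u w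
    proof -
      have "exp (- ((norm u)\<^sup>2 + (norm w)\<^sup>2) / 2) = exp (- (norm u)\<^sup>2 / 2) * exp (- (norm w)\<^sup>2 / 2)"
        unfolding exp_add[symmetric] by (simp add: field_simps)
      then show ?thesis by (simp only: \<phi>_def prod_std_normal_density power2_eq_square[of "_ ^ _"] mult_ac)
    qed
    show ?thesis unfolding prod norm_rotation[OF ab(1)] ..
  qed
  have "(\<integral>\<^sup>+x. \<integral>\<^sup>+y. f (a *\<^sub>R x + b *\<^sub>R y) (a *\<^sub>R y - b *\<^sub>R x) \<partial>std_gaussian \<partial>std_gaussian)
      = (\<integral>\<^sup>+x. \<integral>\<^sup>+y. (\<lambda>u w. ennreal (\<phi> u * \<phi> w) * f u w) (a *\<^sub>R x + b *\<^sub>R y) (a *\<^sub>R y - b *\<^sub>R x) \<partial>lborel \<partial>lborel)"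
    by (subst pair) (simp_all add: inv)
  also have "\<dots> = (\<integral>\<^sup>+x. \<integral>\<^sup>+y. ennreal (\<phi> x * \<phi> y) * f x y \<partial>lborel \<partial>lborel)"
    by (rule nn_integral_lborel_rotation[OF _ ab]) measurable
  also have "\<dots> = (\<integral>\<^sup>+x. \<integral>\<^sup>+y. f x y \<partial>std_gaussian \<partial>std_gaussian)"
    by (rule pair[symmetric]) measurable
  finally show ?thesis .
qed

lemma nn_integral_std_gaussian_mix:
  fixes g :: "'a::euclidean_space \<Rightarrow> ennreal"
  assumes [measurable]: "g \<in> borel_measurable borel" and ab: "a\<^sup>2 + b\<^sup>2 = 1" "b \<noteq> 0"
  shows "(\<integral>\<^sup>+x. \<integral>\<^sup>+y. g (a *\<^sub>R x + b *\<^sub>R y) \<partial>std_gaussian \<partial>std_gaussian) = (\<integral>\<^sup>+x. g x \<partial>std_gaussian)"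
proof -
  have "emeasure (std_gaussian :: 'a measure) UNIV = 1"
    using prob_space.emeasure_space_1[OF prob_space_std_gaussian] by simp
  then show ?thesis
    by (subst nn_integral_std_gaussian_rotation[where f="\<lambda>u w. g u", OF _ ab]) simp_all
qed

lemma gradient_quadratic_potential:
  "gradient (quadratic_potential l) x = l *\<^sub>R (x :: 'a::euclidean_space)"
proof -
  have D: "GDERIV (quadratic_potential l) x :> l *\<^sub>R x"
    unfolding gderiv_def quadratic_potential_def power2_norm_eq_inner
    by (auto intro!: derivative_eq_intros simp: inner_commute)
  show ?thesis unfolding gradient_def
  proof (rule the_equality)
    show "GDERIV (quadratic_potential l) x :> l *\<^sub>R x" by (rule D)
    fix D' assume "GDERIV (quadratic_potential l) x :> D'"
    then have "(\<lambda>y. y \<bullet> D') = (\<lambda>y. y \<bullet> (l *\<^sub>R x))"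
      using D unfolding gderiv_def by (rule has_derivative_unique)
    then show "D' = l *\<^sub>R x" by (simp only: fun_eq_iff vector_eq_ldot)
  qed
qed

section \<open>The OBABO chain of a quadratic potential\<close>

lemma measurable_obabo_step_quadratic:
  "(\<lambda>(z, \<xi>). obabo_step (quadratic_potential l) h \<gamma> z \<xi>)
    \<in> borel \<Otimes>\<^sub>M (std_gaussian \<Otimes>\<^sub>M std_gaussian) \<rightarrow>\<^sub>M (borel :: ('a::euclidean_space \<times> 'a) measure)"
  unfolding obabo_step_def Let_def split_beta gradient_quadratic_potential borel_prod[symmetric]
  by measurable

lemma obabo_kernel_quadratic_measurable:
  "obabo_kernel (quadratic_potential l) h \<gamma>
    \<in> borel \<rightarrow>\<^sub>M prob_algebra (borel :: ('a::euclidean_space \<times> 'a) measure)"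
proof -
  have "prob_space (std_gaussian \<Otimes>\<^sub>M std_gaussian :: ('a \<times> 'a) measure)"
    by (intro prob_space_pair prob_space_std_gaussian)
  then show ?thesis
    unfolding obabo_kernel_def
    by (intro measurable_distr_prob_space2[OF _ measurable_obabo_step_quadratic])
      (simp add: space_prob_algebra)
qed

text \<open>The bound \<open>h\<^sup>2 l < 4\<close> is the linear stability condition of the leapfrog scheme. Under it the
  deterministic part of the step preserves the modified energy \<open>\<omega>\<^sup>2 |x|\<^sup>2 + |v|\<^sup>2\<close>, where
  \<open>\<omega>\<^sup>2 = l (1 - h\<^sup>2 l / 4)\<close> tends to the true value \<open>l\<close> as \<open>h \<rightarrow> 0\<close>. In the coordinates
  \<open>(\<omega> x, v)\<close> it is the rotation with cosine \<open>a\<close> and sine \<open>b\<close>.\<close>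

locale harmonic_obabo =
  fixes l h \<gamma> :: real
  assumes l: "0 < l" and h: "0 < h" and \<gamma>: "0 < \<gamma>" and stable: "h\<^sup>2 * l < 4"
begin

definition r where "r = exp (- \<gamma> * h / 2)"
definition \<sigma> where "\<sigma> = sqrt (1 - r\<^sup>2)"
definition \<omega> where "\<omega> = sqrt (l * (1 - h\<^sup>2 * l / 4))"
definition a where "a = 1 - h\<^sup>2 * l / 2"
definition b where "b = h * \<omega>"

lemma r_bounds: "0 < r" "r < 1" "r\<^sup>2 < 1"
  using h \<gamma> by (auto simp: r_def power_less_one_iff)

lemma thermostat_coeffs: "r\<^sup>2 + \<sigma>\<^sup>2 = 1" "\<sigma> \<noteq> 0"
  using r_bounds(3) by (auto simp: \<sigma>_def)

lemma frequency: "0 < \<omega>" "\<omega>\<^sup>2 = l * (1 - h\<^sup>2 * l / 4)"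
  using l stable by (auto simp: \<omega>_def)

lemma rotation_coeffs: "a\<^sup>2 + b\<^sup>2 = 1" "0 < b"
proof -
  have "b\<^sup>2 = h\<^sup>2 * (l * (1 - h\<^sup>2 * l / 4))" by (simp add: b_def power_mult_distrib frequency(2))
  then show "a\<^sup>2 + b\<^sup>2 = 1" by (simp add: a_def power2_eq_square field_simps)
  show "0 < b" using h frequency(1) by (simp add: b_def)
qed

text \<open>In the coordinates \<open>(\<omega> x, v)\<close> one step mixes the velocity with Gaussian noise, rotates, and
  mixes the velocity with noise again.\<close>

lemma obabo_step_rotation:
  "obabo_step (quadratic_potential l) h \<gamma> ((x, v) :: 'a::euclidean_space \<times> 'a) (\<xi>\<^sub>1, \<xi>\<^sub>2)
    = ((a *\<^sub>R (\<omega> *\<^sub>R x) + b *\<^sub>R (r *\<^sub>R v + \<sigma> *\<^sub>R \<xi>\<^sub>1)) /\<^sub>R \<omega>,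
       r *\<^sub>R (a *\<^sub>R (r *\<^sub>R v + \<sigma> *\<^sub>R \<xi>\<^sub>1) - b *\<^sub>R (\<omega> *\<^sub>R x)) + \<sigma> *\<^sub>R \<xi>\<^sub>2)"
proof -
  define w where "w = r *\<^sub>R v + \<sigma> *\<^sub>R \<xi>\<^sub>1"
  define x' where "x' = x + h *\<^sub>R (w - (h / 2) *\<^sub>R (l *\<^sub>R x))"
  have "x' = a *\<^sub>R x + h *\<^sub>R w"
    by (simp add: x'_def a_def algebra_simps power2_eq_square)
  also have "\<dots> = (a *\<^sub>R (\<omega> *\<^sub>R x) + b *\<^sub>R w) /\<^sub>R \<omega>"
    using frequency(1) by (simp add: b_def scaleR_right_distrib field_simps)
  finally have fst: "x' = (a *\<^sub>R (\<omega> *\<^sub>R x) + b *\<^sub>R w) /\<^sub>R \<omega>" .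
  have "w - (h / 2) *\<^sub>R (l *\<^sub>R x) - (h / 2) *\<^sub>R (l *\<^sub>R x')
      = a *\<^sub>R w - (h * (l * (1 - h\<^sup>2 * l / 4))) *\<^sub>R x"
    by (simp add: x'_def a_def algebra_simps power2_eq_square flip: scaleR_add_left)
  also have "h * (l * (1 - h\<^sup>2 * l / 4)) = b * \<omega>"
    unfolding frequency(2)[symmetric] b_def by (simp add: power2_eq_square)
  finally have snd: "w - (h / 2) *\<^sub>R (l *\<^sub>R x) - (h / 2) *\<^sub>R (l *\<^sub>R x') = a *\<^sub>R w - b *\<^sub>R (\<omega> *\<^sub>R x)"
    by simp
  show ?thesis
    unfolding obabo_step_def Let_def split gradient_quadratic_potential
      r_def[symmetric] \<sigma>_def[symmetric] w_def[symmetric] x'_def[symmetric] snd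
    by (simp add: fst)
qed

text \<open>The Gaussian law under which \<open>\<omega> x\<close> and \<open>v\<close> are independent standard Gaussian vectors; it is
  the Gibbs law of the modified energy and not that of the potential.\<close>

definition stationary_law :: "('a::euclidean_space \<times> 'a) measure" where
  "stationary_law = distr (std_gaussian \<Otimes>\<^sub>M std_gaussian) borel (\<lambda>(X, v). (X /\<^sub>R \<omega>, v))"

lemma measurable_unscale [measurable]:
  "(\<lambda>(X, v). (X /\<^sub>R \<omega>, v)) \<in> std_gaussian \<Otimes>\<^sub>M std_gaussian
    \<rightarrow>\<^sub>M (borel :: ('a::euclidean_space \<times> 'a) measure)"
  unfolding borel_prod[symmetric] by measurable

lemma nn_integral_stationary_law:
  fixes F :: "'a::euclidean_space \<Rightarrow> 'a \<Rightarrow> ennreal"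
  assumes [measurable]: "(\<lambda>(x, v). F x v) \<in> borel_measurable (borel \<Otimes>\<^sub>M borel)"
  shows "(\<integral>\<^sup>+(x, v). F x v \<partial>stationary_law)
    = (\<integral>\<^sup>+X. \<integral>\<^sup>+v. F (X /\<^sub>R \<omega>) v \<partial>std_gaussian \<partial>std_gaussian)"
proof -
  interpret G: prob_space "std_gaussian :: 'a measure" by (rule prob_space_std_gaussian)
  have meas: "(\<lambda>(x, v). F x v) \<in> borel_measurable borel"
    using assms by (simp add: borel_prod)
  have "(\<integral>\<^sup>+(x, v). F x v \<partial>stationary_law)
      = (\<integral>\<^sup>+(X, v). F (X /\<^sub>R \<omega>) v \<partial>(std_gaussian \<Otimes>\<^sub>M std_gaussian))"
    unfolding stationary_law_def
    using meas
    by (subst nn_integral_distr[OF measurable_unscale]) (simp_all add: case_prod_unfold)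
  also have "\<dots> = (\<integral>\<^sup>+X. \<integral>\<^sup>+v. F (X /\<^sub>R \<omega>) v \<partial>std_gaussian \<partial>std_gaussian)"
    by (subst G.nn_integral_fst[symmetric]) auto
  finally show ?thesis .
qed

text \<open>Each of the three stages of the step preserves this law. The two noise stages replace \<open>v\<close> by
  \<open>r v + \<sigma> \<xi>\<close>, which is standard Gaussian since \<open>r\<^sup>2 + \<sigma>\<^sup>2 = 1\<close>, and the middle stage rotates a
  pair of independent standard Gaussian vectors.\<close>

lemma invariant_law_stationary_law:
  "invariant_law (obabo_kernel (quadratic_potential l) h \<gamma>)
    (stationary_law :: ('a::euclidean_space \<times> 'a) measure)"
proof -
  let ?Q = "obabo_kernel (quadratic_potential l) h \<gamma> :: 'a \<times> 'a \<Rightarrow> _"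
  let ?G = "std_gaussian :: 'a measure"
  let ?\<pi> = "stationary_law :: ('a \<times> 'a) measure"
  interpret G: prob_space ?G by (rule prob_space_std_gaussian)
  have prob: "prob_space ?\<pi>"
    unfolding stationary_law_def
    by (intro prob_space.prob_space_distr measurable_unscale prob_space_pair prob_space_std_gaussian)
  have sets: "sets ?\<pi> = sets borel" by (simp add: stationary_law_def)
  have in_alg: "?\<pi> \<in> space (prob_algebra borel)" using prob sets by (simp add: space_prob_algebra)
  have Q: "?Q \<in> borel \<rightarrow>\<^sub>M prob_algebra borel" by (rule obabo_kernel_quadratic_measurable)
  have "?\<pi> \<bind> ?Q = ?\<pi>"
  proof (rule measure_eqI)
    show "sets (?\<pi> \<bind> ?Q) = sets ?\<pi>" unfolding sets_bind'[OF in_alg Q] sets ..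
    fix A assume "A \<in> sets (?\<pi> \<bind> ?Q)"
    then have A: "A \<in> sets borel" unfolding sets_bind'[OF in_alg Q] .
    then have [measurable]: "A \<in> sets (borel \<Otimes>\<^sub>M borel)" unfolding borel_prod .
    define F :: "'a \<Rightarrow> 'a \<Rightarrow> ennreal" where "F x v = indicator A (x, v)" for x v
    have [measurable]: "(\<lambda>(x, v). F x v) \<in> borel_measurable (borel \<Otimes>\<^sub>M borel)"
      unfolding F_def by measurable
    define Fstep where "Fstep x v = (\<integral>\<^sup>+\<xi>\<^sub>1. \<integral>\<^sup>+\<xi>\<^sub>2.
        F ((a *\<^sub>R (\<omega> *\<^sub>R x) + b *\<^sub>R (r *\<^sub>R v + \<sigma> *\<^sub>R \<xi>\<^sub>1)) /\<^sub>R \<omega>)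
          (r *\<^sub>R (a *\<^sub>R (r *\<^sub>R v + \<sigma> *\<^sub>R \<xi>\<^sub>1) - b *\<^sub>R (\<omega> *\<^sub>R x)) + \<sigma> *\<^sub>R \<xi>\<^sub>2) \<partial>?G \<partial>?G)" for x v
    have step: "emeasure (?Q (x, v)) A = Fstep x v" for x v
    proof -
      have meas [measurable]: "obabo_step (quadratic_potential l) h \<gamma> (x, v) \<in> ?G \<Otimes>\<^sub>M ?G \<rightarrow>\<^sub>M borel"
        using measurable_Pair2[OF measurable_obabo_step_quadratic, of "(x, v)"] by simp
      have "emeasure (?Q (x, v)) A
          = (\<integral>\<^sup>+\<xi>. indicator A (obabo_step (quadratic_potential l) h \<gamma> (x, v) \<xi>) \<partial>(?G \<Otimes>\<^sub>M ?G))"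
        unfolding obabo_kernel_def using A
        by (subst nn_integral_distr[OF meas, symmetric]) (auto simp: nn_integral_indicator)
      also have "\<dots> = (\<integral>\<^sup>+\<xi>\<^sub>1. \<integral>\<^sup>+\<xi>\<^sub>2.
          indicator A (obabo_step (quadratic_potential l) h \<gamma> (x, v) (\<xi>\<^sub>1, \<xi>\<^sub>2)) \<partial>?G \<partial>?G)"
        by (rule G.nn_integral_fst[symmetric])
          (rule measurable_compose[OF meas borel_measurable_indicator[OF A]])
      also have "\<dots> = Fstep x v" by (simp only: obabo_step_rotation Fstep_def F_def)
      finally show ?thesis .
    qed
    have [measurable]: "(\<lambda>(x, v). Fstep x v) \<in> borel_measurable (borel \<Otimes>\<^sub>M borel)"
      unfolding Fstep_def by measurable
    \<comment> \<open>\<open>H\<close> is the conditional mean of \<open>F\<close> before the rotation, \<open>K\<close> the one after it; they differ by the rotation only.\<close>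
    define H where "H X w = (\<integral>\<^sup>+\<xi>. F ((a *\<^sub>R X + b *\<^sub>R w) /\<^sub>R \<omega>) (r *\<^sub>R (a *\<^sub>R w - b *\<^sub>R X) + \<sigma> *\<^sub>R \<xi>) \<partial>?G)" for X w
    define K where "K X w = (\<integral>\<^sup>+\<xi>. F (X /\<^sub>R \<omega>) (r *\<^sub>R w + \<sigma> *\<^sub>R \<xi>) \<partial>?G)" for X w
    have [measurable]: "(\<lambda>(X, w). H X w) \<in> borel_measurable (borel \<Otimes>\<^sub>M borel)"
      "(\<lambda>(X, w). K X w) \<in> borel_measurable (borel \<Otimes>\<^sub>M borel)"
      unfolding H_def K_def by measurable
    have "emeasure (?\<pi> \<bind> ?Q) A = (\<integral>\<^sup>+(x, v). Fstep x v \<partial>?\<pi>)"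
      unfolding emeasure_bind_prob_algebra[OF in_alg Q A]
      by (rule nn_integral_cong) (simp add: step split: prod.split)
    also have "\<dots> = (\<integral>\<^sup>+X. \<integral>\<^sup>+v. Fstep (X /\<^sub>R \<omega>) v \<partial>?G \<partial>?G)"
      by (rule nn_integral_stationary_law) measurable
    also have "\<dots> = (\<integral>\<^sup>+X. \<integral>\<^sup>+v. \<integral>\<^sup>+\<xi>\<^sub>1. H X (r *\<^sub>R v + \<sigma> *\<^sub>R \<xi>\<^sub>1) \<partial>?G \<partial>?G \<partial>?G)"
      using frequency(1) by (simp add: Fstep_def H_def)
    also have "\<dots> = (\<integral>\<^sup>+X. \<integral>\<^sup>+w. H X w \<partial>?G \<partial>?G)"
      by (intro nn_integral_cong nn_integral_std_gaussian_mix thermostat_coeffs) measurable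
    also have "\<dots> = (\<integral>\<^sup>+X. \<integral>\<^sup>+w. K (a *\<^sub>R X + b *\<^sub>R w) (a *\<^sub>R w - b *\<^sub>R X) \<partial>?G \<partial>?G)"
      by (simp only: H_def K_def)
    also have "\<dots> = (\<integral>\<^sup>+X. \<integral>\<^sup>+w. K X w \<partial>?G \<partial>?G)"
      using rotation_coeffs by (intro nn_integral_std_gaussian_rotation) auto
    also have "\<dots> = (\<integral>\<^sup>+X. \<integral>\<^sup>+v. F (X /\<^sub>R \<omega>) v \<partial>?G \<partial>?G)"
      unfolding K_def by (intro nn_integral_cong nn_integral_std_gaussian_mix thermostat_coeffs) measurable
    also have "\<dots> = (\<integral>\<^sup>+(x, v). F x v \<partial>?\<pi>)"
      by (rule nn_integral_stationary_law[symmetric]) measurable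
    also have "\<dots> = emeasure ?\<pi> A"
      using A sets by (simp add: F_def split_beta)
    finally show "emeasure (?\<pi> \<bind> ?Q) A = emeasure ?\<pi> A" .
  qed
  then show ?thesis using prob sets by (simp add: invariant_law_def)
qed

definition energy_dist :: "'a::real_normed_vector \<times> 'a \<Rightarrow> 'a \<times> 'a \<Rightarrow> real" where
  "energy_dist z z' = norm (\<omega> *\<^sub>R (fst z - fst z'), snd z - snd z')"

text \<open>The noise cancels in the difference of two synchronously driven copies, and what remains is
  damping of the velocity by \<open>r\<close>, rotation, and damping again. Each damping removes the fraction
  \<open>1 - r\<^sup>2\<close> of the squared velocity difference, which is \<open>V\<close> before the first damping and \<open>U\<close> before
  the second. Since \<open>b \<noteq> 0\<close>, the rotation turns position into velocity, so \<open>V\<close> and \<open>U\<close> cannot both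
  be small unless the position difference \<open>X\<close> is: \<open>b X\<close> is a combination of \<open>V\<close> and \<open>U\<close> with
  coefficients at most 1 in modulus. Thus a fixed fraction of the energy is lost in each step.\<close>

lemma energy_dist_contraction:
  fixes z z' :: "'a::euclidean_space \<times> 'a"
  shows "energy_dist (obabo_step (quadratic_potential l) h \<gamma> z \<xi>) (obabo_step (quadratic_potential l) h \<gamma> z' \<xi>)
    \<le> sqrt (1 - (1 - r\<^sup>2) * b\<^sup>2 / 3) * energy_dist z z'"
proof -
  obtain x v x' v' \<xi>\<^sub>1 \<xi>\<^sub>2 where z: "z = (x, v)" "z' = (x', v')" "\<xi> = (\<xi>\<^sub>1, \<xi>\<^sub>2)"
    by (metis surj_pair)
  define X where "X = \<omega> *\<^sub>R (x - x')"
  define V where "V = v - v'"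
  define U where "U = a *\<^sub>R (r *\<^sub>R V) - b *\<^sub>R X"
  have dist0: "energy_dist z z' = sqrt ((norm X)\<^sup>2 + (norm V)\<^sup>2)"
    by (simp add: energy_dist_def z X_def V_def norm_Pair)
  have "energy_dist (obabo_step (quadratic_potential l) h \<gamma> z \<xi>) (obabo_step (quadratic_potential l) h \<gamma> z' \<xi>)
      = norm (a *\<^sub>R X + b *\<^sub>R (r *\<^sub>R V), r *\<^sub>R U)"
  proof -
    have unscale: "\<omega> *\<^sub>R (A /\<^sub>R \<omega> - B /\<^sub>R \<omega>) = A - B" for A B :: 'a
      using frequency(1) by (simp add: scaleR_right_diff_distrib)
    show ?thesis
      unfolding energy_dist_def z obabo_step_rotation fst_conv snd_conv unscale
      by (intro arg_cong[of _ _ norm]) (simp add: X_def V_def U_def algebra_simps)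
  qed
  also have "\<dots> = sqrt ((norm (a *\<^sub>R X + b *\<^sub>R (r *\<^sub>R V)))\<^sup>2 + r\<^sup>2 * (norm U)\<^sup>2)"
    by (simp add: norm_Pair power_mult_distrib)
  also have "\<dots> \<le> sqrt ((1 - (1 - r\<^sup>2) * b\<^sup>2 / 3) * ((norm X)\<^sup>2 + (norm V)\<^sup>2))"
  proof (rule real_sqrt_le_mono)
    have rot: "(norm (a *\<^sub>R X + b *\<^sub>R (r *\<^sub>R V)))\<^sup>2 = (norm X)\<^sup>2 + r\<^sup>2 * (norm V)\<^sup>2 - (norm U)\<^sup>2"
      using norm_rotation[OF rotation_coeffs(1), of X "r *\<^sub>R V"] by (simp add: U_def power_mult_distrib)
    have "a\<^sup>2 \<le> 1" and b1: "b\<^sup>2 \<le> 1"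
      using rotation_coeffs(1) zero_le_power2[of a] zero_le_power2[of b] by linarith+
    then have a1: "\<bar>a\<bar> \<le> 1" by (simp add: abs_square_le_1)
    have "b *\<^sub>R X = a *\<^sub>R (r *\<^sub>R V) - U" by (simp add: U_def)
    then have "norm (b *\<^sub>R X) \<le> norm (a *\<^sub>R (r *\<^sub>R V)) + norm U" by (metis norm_triangle_ineq4)
    also have "norm (a *\<^sub>R (r *\<^sub>R V)) \<le> norm V"
    proof -
      have "\<bar>a\<bar> * r \<le> 1" using a1 r_bounds by (simp add: mult_le_one)
      then show ?thesis using r_bounds(1) mult_right_mono[of "\<bar>a\<bar> * r" 1 "norm V"] by (simp add: abs_mult mult.assoc)
    qed
    finally have "(norm (b *\<^sub>R X))\<^sup>2 \<le> (norm V + norm U)\<^sup>2" by (intro power_mono) auto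
    then have "b\<^sup>2 * (norm X)\<^sup>2 \<le> (norm V + norm U)\<^sup>2" by (simp add: power_mult_distrib)
    also have "\<dots> \<le> 2 * (norm V)\<^sup>2 + 2 * (norm U)\<^sup>2"
      using zero_le_power2[of "norm V - norm U"] by (simp add: power2_eq_square algebra_simps)
    finally have "b\<^sup>2 * (norm X)\<^sup>2 + b\<^sup>2 * (norm V)\<^sup>2 \<le> 3 * ((norm V)\<^sup>2 + (norm U)\<^sup>2)"
      using mult_right_mono[OF b1, of "(norm V)\<^sup>2"] zero_le_power2[of "norm U"] zero_le_power2[of "norm V"]
      unfolding distrib_left by linarith
    then have "(1 - r\<^sup>2) * (b\<^sup>2 * (norm X)\<^sup>2 + b\<^sup>2 * (norm V)\<^sup>2) \<le> (1 - r\<^sup>2) * (3 * ((norm V)\<^sup>2 + (norm U)\<^sup>2))"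
      using r_bounds(3) by (intro mult_left_mono) auto
    then show "(norm (a *\<^sub>R X + b *\<^sub>R (r *\<^sub>R V)))\<^sup>2 + r\<^sup>2 * (norm U)\<^sup>2
        \<le> (1 - (1 - r\<^sup>2) * b\<^sup>2 / 3) * ((norm X)\<^sup>2 + (norm V)\<^sup>2)"
      unfolding rot by (simp add: field_simps)
  qed
  also have "\<dots> = sqrt (1 - (1 - r\<^sup>2) * b\<^sup>2 / 3) * energy_dist z z'"
    by (simp add: dist0 real_sqrt_mult)
  finally show ?thesis .
qed

lemma energy_dist_comparable:
  fixes z z' :: "'a::real_normed_vector \<times> 'a"
  shows "dist z z' \<le> max 1 (1 / \<omega>) * energy_dist z z'"
    and "energy_dist z z' \<le> max 1 \<omega> * dist z z'"
proof -
  have scale: "norm (c *\<^sub>R x, v) \<le> max 1 c * norm (x, v)" if "0 < c" for c and x v :: 'a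
  proof -
    define m where "m = max 1 c"
    have m: "1 \<le> m" "c \<le> m" by (auto simp: m_def)
    have "(norm (c *\<^sub>R x))\<^sup>2 + (norm v)\<^sup>2 \<le> m\<^sup>2 * (norm x)\<^sup>2 + m\<^sup>2 * (norm v)\<^sup>2"
      using m that one_le_power[OF m(1), of 2] mult_right_mono[of 1 "m\<^sup>2" "(norm v)\<^sup>2"]
      by (intro add_mono) (auto simp: power_mult_distrib intro!: mult_right_mono power_mono)
    then have "sqrt ((norm (c *\<^sub>R x))\<^sup>2 + (norm v)\<^sup>2) \<le> sqrt (m\<^sup>2 * ((norm x)\<^sup>2 + (norm v)\<^sup>2))"
      by (intro real_sqrt_le_mono) (simp add: algebra_simps)
    then show ?thesis using m by (simp add: norm_Pair real_sqrt_mult m_def[symmetric])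
  qed
  have d: "dist z z' = norm (fst z - fst z', snd z - snd z')"
    by (simp add: dist_norm prod_eq_iff minus_prod_def)
  show "energy_dist z z' \<le> max 1 \<omega> * dist z z'"
    unfolding energy_dist_def d using scale[OF frequency(1)] .
  show "dist z z' \<le> max 1 (1 / \<omega>) * energy_dist z z'"
    unfolding energy_dist_def d
    using scale[of "1 / \<omega>" "\<omega> *\<^sub>R (fst z - fst z')" "snd z - snd z'"] frequency(1) by simp
qed

lemma unique_invariant_law_stationary_law:
  "unique_invariant_law (obabo_kernel (quadratic_potential l) h \<gamma>)
    (stationary_law :: ('a::euclidean_space \<times> 'a) measure)"
proof -
  let ?Q = "obabo_kernel (quadratic_potential l) h \<gamma> :: 'a \<times> 'a \<Rightarrow> _"
  have "b\<^sup>2 \<le> 1" using rotation_coeffs(1) zero_le_power2[of a] by linarith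
  moreover have "0 < (1 - r\<^sup>2) * b\<^sup>2" using r_bounds(3) rotation_coeffs(2) by simp
  moreover have "(1 - r\<^sup>2) * b\<^sup>2 \<le> 1 * 1"
    using r_bounds(3) \<open>b\<^sup>2 \<le> 1\<close> by (intro mult_mono) auto
  ultimately have k: "0 \<le> sqrt (1 - (1 - r\<^sup>2) * b\<^sup>2 / 3)" "sqrt (1 - (1 - r\<^sup>2) * b\<^sup>2 / 3) < 1"
    by auto
  have "\<pi>' = stationary_law" if "invariant_law ?Q \<pi>'" for \<pi>'
  proof (rule invariant_law_unique_of_contraction[where N="std_gaussian \<Otimes>\<^sub>M std_gaussian"
        and T="obabo_step (quadratic_potential l) h \<gamma>" and D=energy_dist and Q="?Q"])
    show "prob_space (std_gaussian \<Otimes>\<^sub>M std_gaussian :: ('a \<times> 'a) measure)"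
      by (intro prob_space_pair prob_space_std_gaussian)
    show "?Q = (\<lambda>z. distr (std_gaussian \<Otimes>\<^sub>M std_gaussian) borel (obabo_step (quadratic_potential l) h \<gamma> z))"
      by (rule ext) (rule obabo_kernel_def)
    show "0 \<le> max 1 (1 / \<omega>)" "0 \<le> max 1 \<omega>" by auto
  qed (fact that k measurable_obabo_step_quadratic energy_dist_comparable energy_dist_contraction
        invariant_law_stationary_law)+
  then show ?thesis using invariant_law_stationary_law by (simp add: unique_invariant_law_def)
qed

end

section \<open>The mixing time dichotomy\<close>

theorem corollary1p2:
  fixes C \<kappa> h \<gamma> \<beta> s q :: real
  assumes "C > (3 + sqrt 5)\<^sup>2"
    and "\<kappa> \<ge> 2 * C"
    and "h > 0" and "\<gamma> > 0"
    and "h < 2 / sqrt \<kappa>"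
    and "\<beta> = exp (- \<gamma> * h)"
    and "s = h\<^sup>2 / 2 * (1 + \<beta>)"
    and "q = (1 - C / \<kappa>) / (1 + C / \<kappa>)"
  shows
    "(\<forall>l\<in>{1..\<kappa>}.
        let Q = obabo_kernel (quadratic_potential l :: real^2 \<Rightarrow> real) h \<gamma> in
        (\<exists>y y'. (\<lambda>n. root n (tv_dist (law_after Q y n) (law_after Q y' n)))
                   \<longlonglongrightarrow> quadratic_rate s \<beta> \<kappa>) \<and>
        quadratic_rate s \<beta> \<kappa> \<ge> q
        \<longrightarrow> (\<exists>\<pi>. unique_invariant_law Q \<pi> \<and>
              (\<exists>z z'. \<exists>c>0. \<forall>\<epsilon>\<in>{0<..c / 4}. \<exists>z\<^sub>\<epsilon>\<in>{z, z'}.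
                 ereal_of_enat (mixing_time z\<^sub>\<epsilon> \<epsilon> Q \<pi>)
                   \<ge> ereal (\<kappa> / (3 * C) * ln (c / (4 * \<epsilon>)) - 1))))
     \<and>
     (\<forall>(U :: real^2 \<Rightarrow> real) c\<^sub>0 C\<^sub>0 (\<pi> :: real \<Rightarrow> ((real^2) \<times> (real^2)) measure) z.
        U \<in> potentials \<kappa> \<and> c\<^sub>0 > 0 \<and> C\<^sub>0 > 0 \<and>
        (\<forall>R\<ge>1.
           let U\<^sub>R = rescaled_potential R U; Q = obabo_kernel U\<^sub>R h \<gamma> in
           U\<^sub>R \<in> potentials \<kappa> \<and>
           unique_invariant_law Q (\<pi> R) \<and>
           wasserstein2 (dirac (z R)) (\<pi> R) \<le> ennreal (C\<^sub>0 * (1 + R)) \<and>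
           (\<forall>n::nat. int n \<le> \<lfloor>1 / 16 * exp (c\<^sub>0 * R\<^sup>2)\<rfloor>
              \<longrightarrow> tv_dist (law_after Q (z R) n) (\<pi> R) \<ge> 3 / 8))
        \<longrightarrow>
        (\<forall>R\<ge>1. \<forall>\<epsilon>\<in>{0<..<3 / 8}.
           ereal_of_enat (mixing_time (z R) \<epsilon> (obabo_kernel (rescaled_potential R U) h \<gamma>) (\<pi> R))
             > ereal (of_int \<lfloor>1 / 16 * exp (c\<^sub>0 * R\<^sup>2)\<rfloor>) \<and>
           wasserstein2 (dirac (z R)) (\<pi> R) \<le> ennreal (C\<^sub>0 * (1 + R))))"
proof (intro conjI)
  have C: "0 < C" using assms(1) zero_le_power2[of "3 + sqrt 5"] by linarith
  then have \<kappa>: "0 < \<kappa>" using assms(2) by linarith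
  define x where "x = C / \<kappa>"
  have x: "0 < x" "x \<le> 1 / 2" using C \<kappa> assms(2) by (auto simp: x_def field_simps)
  have q: "exp (- (3 * x)) < q"
    using exp_neg_three_less_ratio[OF x] unfolding assms(8) x_def .
  show "\<forall>l\<in>{1..\<kappa>}.
      let Q = obabo_kernel (quadratic_potential l :: real^2 \<Rightarrow> real) h \<gamma> in
      (\<exists>y y'. (\<lambda>n. root n (tv_dist (law_after Q y n) (law_after Q y' n)))
                 \<longlonglongrightarrow> quadratic_rate s \<beta> \<kappa>) \<and>
      quadratic_rate s \<beta> \<kappa> \<ge> q
      \<longrightarrow> (\<exists>\<pi>. unique_invariant_law Q \<pi> \<and>
            (\<exists>z z'. \<exists>c>0. \<forall>\<epsilon>\<in>{0<..c / 4}. \<exists>z\<^sub>\<epsilon>\<in>{z, z'}.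
               ereal_of_enat (mixing_time z\<^sub>\<epsilon> \<epsilon> Q \<pi>)
                 \<ge> ereal (\<kappa> / (3 * C) * ln (c / (4 * \<epsilon>)) - 1)))"
    unfolding Let_def
  proof (intro ballI impI, elim conjE exE)
    fix l y y'
    let ?Q = "obabo_kernel (quadratic_potential l :: real^2 \<Rightarrow> real) h \<gamma>"
    assume l: "l \<in> {1..\<kappa>}" and rate: "q \<le> quadratic_rate s \<beta> \<kappa>"
      and lim: "(\<lambda>n. root n (tv_dist (law_after ?Q y n) (law_after ?Q y' n)))
        \<longlonglongrightarrow> quadratic_rate s \<beta> \<kappa>"
    interpret harmonic_obabo l h \<gamma>
    proof
      have "h * sqrt \<kappa> < 2" using assms(5) \<kappa> by (simp add: field_simps)
      then have "(h * sqrt \<kappa>)\<^sup>2 < 2\<^sup>2" using assms(3) \<kappa> by (intro power_strict_mono) auto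
      then have "h\<^sup>2 * \<kappa> < 4" using \<kappa> by (simp add: power_mult_distrib)
      moreover have "h\<^sup>2 * l \<le> h\<^sup>2 * \<kappa>" using l by (intro mult_left_mono) auto
      ultimately show "h\<^sup>2 * l < 4" by linarith
    qed (use l assms(3,4) in auto)
    have \<pi>: "unique_invariant_law ?Q stationary_law" by (rule unique_invariant_law_stationary_law)
    have "\<exists>c>0. \<forall>\<epsilon>\<in>{0<..c / 4}. \<exists>z\<in>{y, y'}.
        ereal (ln (c / (4 * \<epsilon>)) / (3 * x) - 1) \<le> ereal_of_enat (mixing_time z \<epsilon> ?Q stationary_law)"
      using q rate x(1)
      by (intro mixing_time_of_tv_rate[OF obabo_kernel_quadratic_measurable invariant_law_stationary_law lim]) auto
    moreover have "ln t / (3 * x) = \<kappa> / (3 * C) * ln t" for t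
      using C \<kappa> by (simp add: x_def)
    ultimately show "\<exists>\<pi>. unique_invariant_law ?Q \<pi> \<and>
        (\<exists>z z'. \<exists>c>0. \<forall>\<epsilon>\<in>{0<..c / 4}. \<exists>z\<^sub>\<epsilon>\<in>{z, z'}.
           ereal_of_enat (mixing_time z\<^sub>\<epsilon> \<epsilon> ?Q \<pi>) \<ge> ereal (\<kappa> / (3 * C) * ln (c / (4 * \<epsilon>)) - 1))"
      using \<pi> by (intro exI[of _ stationary_law] conjI exI[of _ y] exI[of _ y']) simp_all
  qed
  show "\<forall>(U :: real^2 \<Rightarrow> real) c\<^sub>0 C\<^sub>0 (\<pi> :: real \<Rightarrow> ((real^2) \<times> (real^2)) measure) z.
      U \<in> potentials \<kappa> \<and> c\<^sub>0 > 0 \<and> C\<^sub>0 > 0 \<and>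
      (\<forall>R\<ge>1.
         let U\<^sub>R = rescaled_potential R U; Q = obabo_kernel U\<^sub>R h \<gamma> in
         U\<^sub>R \<in> potentials \<kappa> \<and>
         unique_invariant_law Q (\<pi> R) \<and>
         wasserstein2 (dirac (z R)) (\<pi> R) \<le> ennreal (C\<^sub>0 * (1 + R)) \<and>
         (\<forall>n::nat. int n \<le> \<lfloor>1 / 16 * exp (c\<^sub>0 * R\<^sup>2)\<rfloor>
            \<longrightarrow> tv_dist (law_after Q (z R) n) (\<pi> R) \<ge> 3 / 8))
      \<longrightarrow>
      (\<forall>R\<ge>1. \<forall>\<epsilon>\<in>{0<..<3 / 8}.
         ereal_of_enat (mixing_time (z R) \<epsilon> (obabo_kernel (rescaled_potential R U) h \<gamma>) (\<pi> R))
           > ereal (of_int \<lfloor>1 / 16 * exp (c\<^sub>0 * R\<^sup>2)\<rfloor>) \<and>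
         wasserstein2 (dirac (z R)) (\<pi> R) \<le> ennreal (C\<^sub>0 * (1 + R)))"
    unfolding Let_def
  proof (intro allI impI ballI, elim conjE)
    fix U :: "real^2 \<Rightarrow> real" and c\<^sub>0 C\<^sub>0 R \<epsilon> :: real
      and \<pi> :: "real \<Rightarrow> ((real^2) \<times> (real^2)) measure" and z
    let ?Q = "\<lambda>R. obabo_kernel (rescaled_potential R U) h \<gamma>"
    assume R: "1 \<le> R" and \<epsilon>: "\<epsilon> \<in> {0<..<3 / 8}"
      and "\<forall>R\<ge>1. rescaled_potential R U \<in> potentials \<kappa> \<and> unique_invariant_law (?Q R) (\<pi> R) \<and>
        wasserstein2 (dirac (z R)) (\<pi> R) \<le> ennreal (C\<^sub>0 * (1 + R)) \<and>
        (\<forall>n::nat. int n \<le> \<lfloor>1 / 16 * exp (c\<^sub>0 * R\<^sup>2)\<rfloor> \<longrightarrow> tv_dist (law_after (?Q R) (z R) n) (\<pi> R) \<ge> 3 / 8)"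
    then have W: "wasserstein2 (dirac (z R)) (\<pi> R) \<le> ennreal (C\<^sub>0 * (1 + R))"
      and tv: "\<And>n. int n \<le> \<lfloor>1 / 16 * exp (c\<^sub>0 * R\<^sup>2)\<rfloor> \<Longrightarrow> 3 / 8 \<le> tv_dist (law_after (?Q R) (z R) n) (\<pi> R)"
      by blast+
    have "\<epsilon> < tv_dist (law_after (?Q R) (z R) n) (\<pi> R)"
      if "int n \<le> \<lfloor>1 / 16 * exp (c\<^sub>0 * R\<^sup>2)\<rfloor>" for n
      using tv[OF that] \<epsilon> by auto
    then show "ereal (of_int \<lfloor>1 / 16 * exp (c\<^sub>0 * R\<^sup>2)\<rfloor>) < ereal_of_enat (mixing_time (z R) \<epsilon> (?Q R) (\<pi> R)) \<and>
        wasserstein2 (dirac (z R)) (\<pi> R) \<le> ennreal (C\<^sub>0 * (1 + R))"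
      using W by (intro conjI mixing_time_greater)
  qed
qed

end
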